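(* Consider D-SGD with delay $\tau\ge1$ as described in the context. (1) Assume that $f_\xi(x)$ is convex in $x$ for every $\xi$ and $f$ is $\mu$-quasi strongly convex, $\mu\ge0$. Let $0<\gamma\le\frac1{8L\sqrt{2\tau(\tau+2)}}$. Then D-SGD satisfies the parametric assumption of the context with $A'=2L$, $B_1'=B_2'=0$, $D_1'=\frac2{n^2}\sum_{i=1}^n\mathrm{Var}[\nabla f_{\xi_i}(x^* )]$, $\sigma_{1,k}^2\equiv\sigma_{2,k}^2\equiv0$, $\rho_1=\rho_2=1$, $C_1=C_2=0$, $D_2=0$, $G=0$, $F_1=F_2=0$, $D_3=\frac{6\gamma\tau L}{n^2}\sum_{i=1}^n\mathrm{Var}[\nabla f_{\xi_i}(x^* )]$, and for all $K\ge0$ $$\mathbf E[f(\bar x^K)-f(x^* )]\le\left(1-\frac{\gamma\mu}2\right)^K\frac{4\|x^0-x^*\|^2}\gamma+\frac{8\gamma}{n^2}(1+3L\gamma\tau)\sum_{i=1}^n\mathrm{Var}[\nabla f_{\xi_i}(x^* )]$$ when $\mu>0$, and $$\mathbf E[f(\bar x^K)-f(x^* )]\le\frac{4\|x^0-x^*\|^2}{\gamma K}+\frac{8\gamma}{n^2}(1+3L\gamma\tau)\sum_{i=1}^n\mathrm{Var}[\nabla f_{\xi_i}(x^* )]$$ when $\mu=0$ (right-hand side read as $+\infty$ for $K=0$). (2) If instead the $f_i$ are $\mu$-strongly convex with $\mu>0$ and the $f_{\xi_i}$ are possibly non-convex, then, with $\kappa=\frac L\mu$ and $0<\gamma\le\min\left\{\frac1{8\kappa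 L},\frac1{8L\sqrt{2\tau(\tau+2\kappa)}}\right\}$, D-SGD satisfies the parametric assumption with $A'=2\kappa L$ and all other parameters as in (1), and for all $K\ge0$ $$\mathbf E[f(\bar x^K)-f(x^* )]\le\left(1-\frac{\gamma\mu}2\right)^K\frac{4\|x^0-x^*\|^2}\gamma+\frac{8\gamma}{n^2}(1+3L\gamma\tau)\sum_{i=1}^n\mathrm{Var}[\nabla f_{\xi_i}(x^* )].$$
   Context: $f(x)=\frac1n\sum_{i=1}^nf_i(x)$ on $\mathbb R^d$, $f_i(x)=\mathbf E_{\xi_i\sim\mathcal D_i}[f_{\xi_i}(x)]$, where $f_{\xi_i}$ is differentiable and $L$-smooth (gradient $L$-Lipschitz) almost surely in $\xi_i$, with $\mathbf E[\nabla f_{\xi_i}(x)]=\nabla f_i(x)$. $\mathrm{Var}[\nabla f_{\xi_i}(x^* )]=\mathbf E\|\nabla f_{\xi_i}(x^* )-\nabla f_i(x^* )\|^2$. $f$ is $\mu$-quasi strongly convex if it has a unique minimizer $x^*$ and $f(x^* )\ge f(x)+\langle\nabla f(x),x^*-x\rangle+\frac\mu2\|x-x^*\|^2$ for all $x$. Delayed framework with integer delay $\tau\ge1$: $x^{k+1}=x^k-\frac1n\sum_iv_i^k$, where $v_i^k=\gamma g_i^{k-\tau}$ if $k\ge\tau$ and $v_i^k=0$ if $k<\tau$; $e_i^{k+1}=e_i^k+\gamma g_i^k-v_i^k$, $e_i^0=0$; $x^0$ deterministic. D-SGD: for $k\ge0$ the workers sample $\xi_i^k\sim\mathcal D_i$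 (independently over $i$ and $k$) and $g_i^k=\nabla f_{\xi_i^k}(x^k)-\nabla f_i(x^* )$ (the terms $\nabla f_i(x^* )$ cancel in the average over $i$). Parametric assumption: let $g^k=\frac1n\sum_ig_i^k$, $e^k=\frac1n\sum_ie_i^k$, $\mathbf E_k$ the conditional expectation given all $\xi_i^t$, $t<k$. For all $k,K\ge0$: $\mathbf E_k[g^k]=\nabla f(x^k)$; $\mathbf E_k\|g^k\|^2\le2A'(f(x^k)-f(x^* ))+B_1'\sigma_{1,k}^2+B_2'\sigma_{2,k}^2+D_1'$; $\mathbf E_k[\sigma_{1,k+1}^2]\le(1-\rho_1)\sigma_{1,k}^2+2C_1(f(x^k)-f(x^* ))+G\rho_1\sigma_{2,k}^2+D_2$; $\mathbf E_k[\sigma_{2,k+1}^2]\le(1-\rho_2)\sigma_{2,k}^2+2C_2(f(x^k)-f(x^* ))$; $3L\sum_{k=0}^Kw_k\mathbf E\|e^k\|^2\le\frac14\sum_{k=0}^Kw_k\mathbf E[f(x^k)-f(x^* )]+F_1\sigma_{1,0}^2+F_2\sigma_{2,0}^2+\gamma D_3W_K$, where $w_k=(1-\eta)^{-(k+1)}$, $W_K=\sum_{k=0}^Kw_k$, $\eta=\min\{\frac{\gamma\mu}2,\frac{\rho_1}4,\frac{\rho_2}4\}$. Also $\bar x^K=\frac1{W_K}\sum_{k=0}^Kw_kx^k$. *)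

theory Defs
  imports "HOL-Probability.Probability"
begin

definition grad :: "('a::euclidean_space \<Rightarrow> real) \<Rightarrow> 'a \<Rightarrow> 'a" where
  "grad h x = (THE d. GDERIV h x :> d)"

definition L_smooth :: "real \<Rightarrow> ('a::euclidean_space \<Rightarrow> real) \<Rightarrow> bool" where
  "L_smooth L h \<longleftrightarrow> (\<forall>x. h differentiable (at x)) \<and> L-lipschitz_on UNIV (grad h)"

definition minimizer :: "('a::euclidean_space \<Rightarrow> real) \<Rightarrow> 'a" where
  "minimizer h = arg_min h (\<lambda>_. True)"

definition quasi_strongly_convex :: "real \<Rightarrow> ('a::euclidean_space \<Rightarrow> real) \<Rightarrow> bool" where
  "quasi_strongly_convex \<mu> h \<longleftrightarrow>
     (\<exists>!x. is_arg_min h (\<lambda>_. True) x) \<and>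
     (\<forall>x. h (minimizer h) \<ge>
        h x + grad h x \<bullet> (minimizer h - x) + \<mu> / 2 * (norm (x - minimizer h))\<^sup>2)"

definition strongly_convex :: "real \<Rightarrow> ('a::euclidean_space \<Rightarrow> real) \<Rightarrow> bool" where
  "strongly_convex \<mu> h \<longleftrightarrow>
     (\<forall>x. h differentiable (at x)) \<and>
     (\<forall>x y. h y \<ge> h x + grad h x \<bullet> (y - x) + \<mu> / 2 * (norm (y - x))\<^sup>2)"

text \<open>Workers are indexed by \<open>{..<n}\<close>; \<open>F i s\<close> is the sample function \<open>f_s\<close> of worker \<open>i\<close>,
  where the sample \<open>s\<close> has law \<open>D i\<close>.\<close>

definition local_loss ::
  "(nat \<Rightarrow> 's measure) \<Rightarrow> (nat \<Rightarrow> 's \<Rightarrow> 'a::euclidean_space \<Rightarrow> real) \<Rightarrow> nat \<Rightarrow> 'a \<Rightarrow> real" where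
  "local_loss D F i x = (\<integral>s. F i s x \<partial>D i)"

definition average :: "nat \<Rightarrow> (nat \<Rightarrow> 'b::real_vector) \<Rightarrow> 'b" where
  "average n u = (1 / real n) *\<^sub>R (\<Sum>i<n. u i)"

definition objective ::
  "nat \<Rightarrow> (nat \<Rightarrow> 's measure) \<Rightarrow> (nat \<Rightarrow> 's \<Rightarrow> 'a::euclidean_space \<Rightarrow> real) \<Rightarrow> 'a \<Rightarrow> real" where
  "objective n D F x = average n (\<lambda>i. local_loss D F i x)"

definition grad_var ::
  "(nat \<Rightarrow> 's measure) \<Rightarrow> (nat \<Rightarrow> 's \<Rightarrow> 'a::euclidean_space \<Rightarrow> real) \<Rightarrow> nat \<Rightarrow> 'a \<Rightarrow> real" where
  "grad_var D F i x = (\<integral>s. (norm (grad (F i s) x - grad (local_loss D F i) x))\<^sup>2 \<partial>D i)"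

text \<open>The measurability and integrability assumptions below say that the random variables and
  expectations involved are well defined. Joint measurability of the stochastic gradient has to be
  assumed because differentiability holds only almost surely. Finiteness of the variance at the
  minimizer is needed because the variance is a real number, and a Bochner integral of a
  non-integrable function would be 0 instead of infinity.\<close>

locale stochastic_finite_sum =
  fixes n :: nat
    and D :: "nat \<Rightarrow> 's measure"
    and F :: "nat \<Rightarrow> 's \<Rightarrow> 'a::euclidean_space \<Rightarrow> real"
    and L :: real
  assumes n_pos: "n \<ge> 1"
    and L_pos: "L > 0"
    and prob_D: "i < n \<Longrightarrow> prob_space (D i)"
    and loss_integrable: "i < n \<Longrightarrow> integrable (D i) (\<lambda>s. F i s x)"
    and smooth: "i < n \<Longrightarrow> AE s in D i. L_smooth L (F i s)"
    and grad_measurable: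
      "i < n \<Longrightarrow> (\<lambda>(s, x). grad (F i s) x) \<in> borel_measurable (D i \<Otimes>\<^sub>M borel)"
    and local_loss_differentiable: "i < n \<Longrightarrow> local_loss D F i differentiable (at x)"
    and grad_integrable: "i < n \<Longrightarrow> integrable (D i) (\<lambda>s. grad (F i s) x)"
    and grad_unbiased: "i < n \<Longrightarrow> (\<integral>s. grad (F i s) x \<partial>D i) = grad (local_loss D F i) x"
    and var_finite: "i < n \<Longrightarrow> integrable (D i)
      (\<lambda>s. (norm (grad (F i s) (minimizer (objective n D F))
              - grad (local_loss D F i) (minimizer (objective n D F))))\<^sup>2)"

text \<open>\<open>\<xi> i k\<close> is the sample drawn by worker \<open>i\<close> at step \<open>k\<close>; \<open>g\<close>, \<open>v\<close>, \<open>e\<close> carry the worker index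
  first and the step second.\<close>

locale delayed_sgd = prob_space M + stochastic_finite_sum n D F L
  for M :: "'o measure"
    and n :: nat
    and D :: "nat \<Rightarrow> 's measure"
    and F :: "nat \<Rightarrow> 's \<Rightarrow> 'a::euclidean_space \<Rightarrow> real"
    and L :: real +
  fixes \<xi> :: "nat \<Rightarrow> nat \<Rightarrow> 'o \<Rightarrow> 's"
    and \<tau> :: nat
    and \<gamma> :: real
    and x0 :: 'a
    and x :: "nat \<Rightarrow> 'o \<Rightarrow> 'a"
    and g v e :: "nat \<Rightarrow> nat \<Rightarrow> 'o \<Rightarrow> 'a"
  assumes sample_law: "i < n \<Longrightarrow> distr M (D i) (\<xi> i k) = D i"
    and sample_indep: "indep_vars (\<lambda>(i, k). D i) (\<lambda>(i, k). \<xi> i k) ({..<n} \<times> UNIV)"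
    and delay_pos: "\<tau> \<ge> 1"
    and x_0: "x 0 \<omega> = x0"
    and x_Suc: "x (Suc k) \<omega> = x k \<omega> - average n (\<lambda>i. v i k \<omega>)"
    and v_eq: "i < n \<Longrightarrow> v i k \<omega> = (if \<tau> \<le> k then \<gamma> *\<^sub>R g i (k - \<tau>) \<omega> else 0)"
    and e_0: "i < n \<Longrightarrow> e i 0 \<omega> = 0"
    and e_Suc: "i < n \<Longrightarrow> e i (Suc k) \<omega> = e i k \<omega> + \<gamma> *\<^sub>R g i k \<omega> - v i k \<omega>"
    and g_eq: "i < n \<Longrightarrow> g i k \<omega> =
      grad (F i (\<xi> i k \<omega>)) (x k \<omega>) - grad (local_loss D F i) (minimizer (objective n D F))"

text \<open>The sigma-algebra generated by all samples drawn before step \<open>k\<close>.\<close>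

definition history ::
  "'o measure \<Rightarrow> nat \<Rightarrow> (nat \<Rightarrow> 's measure) \<Rightarrow> (nat \<Rightarrow> nat \<Rightarrow> 'o \<Rightarrow> 's) \<Rightarrow> nat \<Rightarrow> 'o measure" where
  "history M n D \<xi> k =
     sigma (space M) (\<Union>i<n. \<Union>t<k. {\<xi> i t -` A \<inter> space M | A. A \<in> sets (D i)})"

definition vec_cond_exp ::
  "'o measure \<Rightarrow> 'o measure \<Rightarrow> ('o \<Rightarrow> 'a::euclidean_space) \<Rightarrow> 'o \<Rightarrow> 'a" where
  "vec_cond_exp M H X \<omega> = (\<Sum>b\<in>Basis. real_cond_exp M H (\<lambda>\<omega>. X \<omega> \<bullet> b) \<omega> *\<^sub>R b)"

definition rate :: "real \<Rightarrow> real \<Rightarrow> real \<Rightarrow> real \<Rightarrow> real" where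
  "rate \<gamma> \<mu> \<rho>1 \<rho>2 = min (\<gamma> * \<mu> / 2) (min (\<rho>1 / 4) (\<rho>2 / 4))"

definition weight :: "real \<Rightarrow> nat \<Rightarrow> real" where
  "weight \<eta> k = inverse ((1 - \<eta>) ^ (k + 1))"

definition total_weight :: "real \<Rightarrow> nat \<Rightarrow> real" where
  "total_weight \<eta> K = (\<Sum>k\<le>K. weight \<eta> k)"

definition weighted_average :: "real \<Rightarrow> (nat \<Rightarrow> 'o \<Rightarrow> 'a::real_vector) \<Rightarrow> nat \<Rightarrow> 'o \<Rightarrow> 'a" where
  "weighted_average \<eta> x K \<omega> =
     (1 / total_weight \<eta> K) *\<^sub>R (\<Sum>k\<le>K. weight \<eta> k *\<^sub>R x k \<omega>)"

record sgd_params =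
  par_A :: real
  par_B1 :: real
  par_B2 :: real
  par_C1 :: real
  par_C2 :: real
  par_D1 :: real
  par_D2 :: real
  par_D3 :: real
  par_F1 :: real
  par_F2 :: real
  par_G :: real
  par_rho1 :: real
  par_rho2 :: real

text \<open>The process \<open>\<sigma>1\<close> is the sequence of the \<open>\<sigma>\<^sub>1\<^sub>,\<^sub>k\<close> themselves, so that it enters squared. All expectations
  come with the integrability that makes them meaningful. \<open>H k\<close> is the information available before
  step \<open>k\<close>; \<open>g\<close> and \<open>e\<close> are the per-worker processes, averaged inside the definition.\<close>

definition parametric_assumption ::
  "'o measure \<Rightarrow> (nat \<Rightarrow> 'o measure) \<Rightarrow> ('a::euclidean_space \<Rightarrow> real) \<Rightarrow> real \<Rightarrow> real \<Rightarrow> real \<Rightarrow> nat \<Rightarrow>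
   (nat \<Rightarrow> 'o \<Rightarrow> 'a) \<Rightarrow> (nat \<Rightarrow> nat \<Rightarrow> 'o \<Rightarrow> 'a) \<Rightarrow> (nat \<Rightarrow> nat \<Rightarrow> 'o \<Rightarrow> 'a) \<Rightarrow>
   (nat \<Rightarrow> 'o \<Rightarrow> real) \<Rightarrow> (nat \<Rightarrow> 'o \<Rightarrow> real) \<Rightarrow> sgd_params \<Rightarrow> bool" where
  "parametric_assumption M H f L \<mu> \<gamma> n x g e \<sigma>1 \<sigma>2 p \<longleftrightarrow>
    (let gavg = (\<lambda>k \<omega>. average n (\<lambda>i. g i k \<omega>));
         eavg = (\<lambda>k \<omega>. average n (\<lambda>i. e i k \<omega>));
         gap = (\<lambda>k \<omega>. f (x k \<omega>) - f (minimizer f));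
         \<eta> = rate \<gamma> \<mu> (par_rho1 p) (par_rho2 p)
     in
      (\<forall>k. integrable M (gavg k)
         \<and> integrable M (\<lambda>\<omega>. (norm (gavg k \<omega>))\<^sup>2)
         \<and> integrable M (\<lambda>\<omega>. (norm (eavg k \<omega>))\<^sup>2)
         \<and> integrable M (gap k)
         \<and> integrable M (\<lambda>\<omega>. (\<sigma>1 k \<omega>)\<^sup>2)
         \<and> integrable M (\<lambda>\<omega>. (\<sigma>2 k \<omega>)\<^sup>2))
    \<and> (\<forall>k. AE \<omega> in M. vec_cond_exp M (H k) (gavg k) \<omega> = grad f (x k \<omega>))
    \<and> (\<forall>k. AE \<omega> in M. real_cond_exp M (H k) (\<lambda>\<omega>. (norm (gavg k \<omega>))\<^sup>2) \<omega>
         \<le> 2 * par_A p * gap k \<omega> + par_B1 p * (\<sigma>1 k \<omega>)\<^sup>2 + par_B2 p * (\<sigma>2 k \<omega>)\<^sup>2 + par_D1 p)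
    \<and> (\<forall>k. AE \<omega> in M. real_cond_exp M (H k) (\<lambda>\<omega>. (\<sigma>1 (Suc k) \<omega>)\<^sup>2) \<omega>
         \<le> (1 - par_rho1 p) * (\<sigma>1 k \<omega>)\<^sup>2 + 2 * par_C1 p * gap k \<omega>
            + par_G p * par_rho1 p * (\<sigma>2 k \<omega>)\<^sup>2 + par_D2 p)
    \<and> (\<forall>k. AE \<omega> in M. real_cond_exp M (H k) (\<lambda>\<omega>. (\<sigma>2 (Suc k) \<omega>)\<^sup>2) \<omega>
         \<le> (1 - par_rho2 p) * (\<sigma>2 k \<omega>)\<^sup>2 + 2 * par_C2 p * gap k \<omega>)
    \<and> (\<forall>K. AE \<omega> in M.
         3 * L * (\<Sum>k\<le>K. weight \<eta> k * (\<integral>\<omega>'. (norm (eavg k \<omega>'))\<^sup>2 \<partial>M))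
         \<le> 1 / 4 * (\<Sum>k\<le>K. weight \<eta> k * (\<integral>\<omega>'. gap k \<omega>' \<partial>M))
            + par_F1 p * (\<sigma>1 0 \<omega>)\<^sup>2 + par_F2 p * (\<sigma>2 0 \<omega>)\<^sup>2
            + \<gamma> * par_D3 p * total_weight \<eta> K))"

end

theory Submission
  imports Defs
begin

text \<open>
  Let \<open>x\<^sup>*\<close> be the minimizer of \<open>f\<close>, and let \<open>g\<^sup>k\<close> and \<open>e\<^sup>k\<close> be the averages of the \<open>g\<^sub>i\<^sup>k\<close> and
  the \<open>e\<^sub>i\<^sup>k\<close> over the workers. The errors are designed so that the virtual iterate \<open>y\<^sup>k = x\<^sup>k - e\<^sup>k\<close>
  performs undelayed stochastic gradient steps \<open>y\<^sup>k\<^sup>+\<^sup>1 = y\<^sup>k - \<gamma> g\<^sup>k\<close>, the only defect being that the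
  gradient is evaluated at \<open>x\<^sup>k\<close>. Expanding \<open>\<parallel>y\<^sup>k\<^sup>+\<^sup>1 - x\<^sup>*\<parallel>\<^sup>2\<close> and using quasi strong convexity, that defect
  costs only \<open>3 L \<gamma> E\<parallel>e\<^sup>k\<parallel>\<^sup>2\<close> (\<open>virtual_recursion\<close>). It remains to control the second moments of \<open>g\<^sup>k\<close> and
  of \<open>e\<^sup>k\<close>; multiplying the recursion by \<open>w\<^sub>k\<close> then makes it telescope (\<open>weighted_recursion_bound\<close>), and
  Jensen's inequality passes from the iterates to their weighted average.

  Both second moments rest on one decomposition. Since \<open>\<nabla>f(x\<^sup>*) = 0\<close>, the average \<open>g\<^sup>k\<close> is the sum of the
  drift (the sampled gradients at \<open>x\<^sup>k\<close> minus those at \<open>x\<^sup>*\<close>) and the noise (the centred sampled gradients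
  at \<open>x\<^sup>*\<close>). The noise has second moment exactly \<open>V/n\<^sup>2\<close>, where \<open>V\<close> is the sum of the
  variances at \<open>x\<^sup>*\<close>, because the workers are independent. The second moment of the drift is at most \<open>2 \<kappa> L (f(x\<^sup>k) - f(x\<^sup>*))\<close>, where \<open>\<kappa> = 1\<close> for convex samples, by
  cocoercivity, and \<open>\<kappa> = L/\<mu>\<close> for strongly convex local losses, by the Lipschitz property and
  quadratic growth of \<open>f\<close>. This inequality, \<open>sample_grad_growth\<close>, is the essential difference between the
  two parts of the theorem; the estimates are carried out once for an arbitrary \<open>\<kappa> > 0\<close>.

  The error \<open>e\<^sup>k\<close> is \<open>\<gamma>\<close> times the sum of the at most \<open>\<tau>\<close> most recent \<open>g\<^sup>t\<close>. Splitting the drift further into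
  \<open>\<nabla>f(x\<^sup>t)\<close> and a fluctuation of conditional mean zero, the fluctuations and the noises are two
  orthogonal sequences, so their sums cost only a factor \<open>\<tau>\<close> and not \<open>\<tau>\<^sup>2\<close> (\<open>ebar_second_moment\<close>). The
  step size bounds give \<open>\<mu> \<gamma> \<tau> \<le> 1/8\<close>, so that the weights change by a factor of at most \<open>4/3\<close> over a
  window of length \<open>\<tau>\<close>; summing with weights then yields the last inequality of the parametric
  assumption (\<open>weighted_error_bound\<close>).

  The probabilistic input is that a fresh sample is independent of the \<open>\<sigma>\<close>-algebra of any family of
  other samples, so expectations can be computed by integrating over that sample with everything else
  held fixed (\<open>freeze_sample\<close>).
\<close>

section \<open>Gradients, smoothness and convexity\<close>

lemma norm_add_sq_le: "(norm (a + b :: 'a::real_inner))\<^sup>2 \<le> 2 * (norm a)\<^sup>2 + 2 * (norm b)\<^sup>2"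
proof -
  have "0 \<le> (norm (a - b))\<^sup>2" by simp
  then show ?thesis by (simp add: power2_norm_eq_inner inner_simps inner_commute)
qed

lemma norm_sum_sq_le:
  fixes u :: "'i \<Rightarrow> 'a::real_inner"
  shows "(norm (\<Sum>i\<in>I. u i))\<^sup>2 \<le> real (card I) * (\<Sum>i\<in>I. (norm (u i))\<^sup>2)"
proof -
  have "(norm (\<Sum>i\<in>I. u i))\<^sup>2 \<le> (\<Sum>i\<in>I. 1 * norm (u i))\<^sup>2"
    using norm_sum[of u I] by (simp add: power_mono)
  also have "\<dots> \<le> (\<Sum>i\<in>I. 1\<^sup>2) * (\<Sum>i\<in>I. (norm (u i))\<^sup>2)"
    by (rule Cauchy_Schwarz_ineq_sum)
  finally show ?thesis by simp
qed

lemma norm_average_sq_le: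
  fixes u :: "nat \<Rightarrow> 'a::real_inner"
  shows "(norm (average n u))\<^sup>2 \<le> average n (\<lambda>i. (norm (u i))\<^sup>2)"
proof (cases "n = 0")
  case False
  then show ?thesis
    using norm_sum_sq_le[of u "{..<n}"]
    by (simp add: average_def power_mult_distrib field_simps power2_eq_square)
qed (simp add: average_def)

lemma norm_diff_sq:
  "(norm (a - c *\<^sub>R b))\<^sup>2 = (norm a)\<^sup>2 - 2 * c * (a \<bullet> b) + c\<^sup>2 * (norm (b::'a::real_inner))\<^sup>2"
  unfolding power2_norm_eq_inner by (simp add: inner_simps inner_commute power2_eq_square algebra_simps)

text \<open>The Riesz representation of the derivative provides the vector whose uniqueness makes the
  description operator in the definition of the gradient meaningful.\<close>
lemma GDERIV_grad:
  fixes h :: "'a::euclidean_space \<Rightarrow> real"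
  assumes "h differentiable (at x)"
  shows "GDERIV h x :> grad h x"
proof -
  obtain h' where h': "(h has_derivative h') (at x)"
    using assms by (auto simp: differentiable_def)
  then interpret bounded_linear h' by (rule has_derivative_bounded_linear)
  define d where "d = (\<Sum>b\<in>Basis. h' b *\<^sub>R b)"
  have "h' y = y \<bullet> d" for y
  proof -
    have "h' y = h' (\<Sum>b\<in>Basis. (y \<bullet> b) *\<^sub>R b)" by (simp add: euclidean_representation)
    also have "\<dots> = y \<bullet> d" by (simp add: sum scaleR d_def inner_sum_right mult.commute)
    finally show ?thesis .
  qed
  then have "h' = (\<lambda>y. y \<bullet> d)" by auto
  then have ex: "GDERIV h x :> d" using h' by (simp add: gderiv_def)
  have "d1 = d" if "GDERIV h x :> d1" for d1
  proof -
    have "(\<lambda>y. y \<bullet> d1) = (\<lambda>y. y \<bullet> d)"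
      using has_derivative_unique that ex unfolding gderiv_def by blast
    then show ?thesis by (metis vector_eq_ldot)
  qed
  with ex show ?thesis unfolding grad_def by (rule theI)
qed

lemma grad_eqI:
  fixes h :: "'a::euclidean_space \<Rightarrow> real"
  assumes "GDERIV h x :> d"
  shows "grad h x = d"
proof -
  have "h differentiable (at x)" using assms by (auto simp: gderiv_def differentiable_def)
  from GDERIV_grad[OF this] assms have "(\<lambda>y. y \<bullet> grad h x) = (\<lambda>y. y \<bullet> d)"
    using has_derivative_unique unfolding gderiv_def by blast
  then show ?thesis by (metis vector_eq_ldot)
qed

lemma has_real_derivative_along_line:
  fixes h :: "'a::euclidean_space \<Rightarrow> real"
  assumes "h differentiable (at (x + t *\<^sub>R u))"
  shows "((\<lambda>t. h (x + t *\<^sub>R u)) has_real_derivative grad h (x + t *\<^sub>R u) \<bullet> u) (at t)"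
proof -
  have *: "(h has_derivative (\<lambda>y. y \<bullet> grad h (x + t *\<^sub>R u))) (at (x + t *\<^sub>R u))"
    using GDERIV_grad[OF assms] by (simp add: gderiv_def)
  have "((\<lambda>t. x + t *\<^sub>R u) has_derivative (\<lambda>s. s *\<^sub>R u)) (at t)"
    by (auto intro!: derivative_eq_intros)
  from has_derivative_compose[OF this *] show ?thesis
    by (simp add: has_field_derivative_def inner_commute mult_commute_abs)
qed

text \<open>Along the segment from \<open>x\<close> to \<open>y\<close>, the difference of the two sides has a nonpositive
  derivative, by the Lipschitz bound on the gradient.\<close>
lemma descent_lemma:
  fixes h :: "'a::euclidean_space \<Rightarrow> real"
  assumes "L_smooth L h"
  shows "h y \<le> h x + grad h x \<bullet> (y - x) + L / 2 * (norm (y - x))\<^sup>2"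
proof -
  define u where "u = y - x"
  define p where "p t = h (x + t *\<^sub>R u) - t * (grad h x \<bullet> u) - L / 2 * t\<^sup>2 * (norm u)\<^sup>2" for t
  have "p 1 \<le> p 0"
  proof (rule DERIV_nonpos_imp_nonincreasing[where f = p])
    fix t :: real assume t: "0 \<le> t" "t \<le> 1"
    have D: "(p has_real_derivative
        grad h (x + t *\<^sub>R u) \<bullet> u - grad h x \<bullet> u - L * t * (norm u)\<^sup>2) (at t)"
      unfolding p_def
      by (rule derivative_eq_intros has_real_derivative_along_line refl
            | use assms in \<open>simp add: L_smooth_def\<close>)+
    have "norm (grad h (x + t *\<^sub>R u) - grad h x) \<le> L * norm (t *\<^sub>R u)"
      using lipschitz_onD[of L UNIV "grad h" "x + t *\<^sub>R u" x] assms
      by (simp add: L_smooth_def dist_norm)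
    then have "(grad h (x + t *\<^sub>R u) - grad h x) \<bullet> u \<le> L * norm (t *\<^sub>R u) * norm u"
      using norm_cauchy_schwarz[of "grad h (x + t *\<^sub>R u) - grad h x" u]
      by (meson mult_right_mono norm_ge_zero order_trans)
    then show "\<exists>d. (p has_real_derivative d) (at t) \<and> d \<le> 0"
      using t D by (intro exI[of _ "grad h (x + t *\<^sub>R u) \<bullet> u - grad h x \<bullet> u - L * t * (norm u)\<^sup>2"])
        (simp add: inner_diff_left power2_eq_square mult.assoc)
  qed auto
  then show ?thesis by (simp add: p_def u_def)
qed

text \<open>One gradient step of length \<open>1/L\<close> decreases \<open>h\<close> by at least \<open>\<parallel>\<nabla>h(x)\<parallel>\<^sup>2 / (2L)\<close>, but not below
  \<open>m\<close>.\<close>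
lemma grad_norm_sq_le_gap:
  fixes h :: "'a::euclidean_space \<Rightarrow> real"
  assumes "L_smooth L h" "L > 0" and lower: "\<And>z. m \<le> h z"
  shows "(norm (grad h x))\<^sup>2 \<le> 2 * L * (h x - m)"
proof -
  let ?d = "grad h x"
  have "m \<le> h (x - (1 / L) *\<^sub>R ?d)" by (rule lower)
  also have "\<dots> \<le> h x - (1 / L) * (norm ?d)\<^sup>2 + L / 2 * ((norm ?d)\<^sup>2 / L\<^sup>2)"
    using descent_lemma[OF assms(1), of "x - (1 / L) *\<^sub>R ?d" x]
    by (simp add: power2_norm_eq_inner power_divide)
  also have "\<dots> = h x - (norm ?d)\<^sup>2 / (2 * L)"
    using assms(2) by (simp add: power2_eq_square field_simps)
  finally show ?thesis using assms(2) by (simp add: field_simps)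
qed

lemma convex_above_tangent:
  fixes h :: "'a::euclidean_space \<Rightarrow> real"
  assumes "convex_on UNIV h" "h differentiable (at y)"
  shows "h z \<ge> h y + grad h y \<bullet> (z - y)"
proof -
  define u where "u = z - y"
  have "((\<lambda>t. h (y + t *\<^sub>R u)) has_real_derivative grad h y \<bullet> u) (at 0)"
    using has_real_derivative_along_line[of h y 0 u] assms(2) by simp
  then have "(\<lambda>t. (h (y + t *\<^sub>R u) - h y) / t) \<midarrow>0\<rightarrow> grad h y \<bullet> u"
    by (simp add: DERIV_def)
  then have lim: "((\<lambda>t. (h (y + t *\<^sub>R u) - h y) / t) \<longlongrightarrow> grad h y \<bullet> u) (at_right 0)"
    by (rule filterlim_mono) (auto intro: at_le)
  have "\<forall>\<^sub>F t in at_right 0. (h (y + t *\<^sub>R u) - h y) / t \<le> h z - h y"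
    unfolding eventually_at_right_field
  proof (intro exI[of _ "1::real"] conjI allI impI)
    fix t :: real assume t: "0 < t" "t < 1"
    have "h ((1 - t) *\<^sub>R y + t *\<^sub>R z) \<le> (1 - t) * h y + t * h z"
      using t by (intro convex_onD[OF assms(1)]) auto
    moreover have "(1 - t) *\<^sub>R y + t *\<^sub>R z = y + t *\<^sub>R u" by (simp add: u_def algebra_simps)
    ultimately show "(h (y + t *\<^sub>R u) - h y) / t \<le> h z - h y"
      using t by (simp add: field_simps)
  qed auto
  from tendsto_upperbound[OF lim this] show ?thesis by (simp add: u_def)
qed

text \<open>Subtracting from \<open>h\<close> its linear part at \<open>y\<close> gives a smooth function that is minimal at \<open>y\<close>,
  to which \<open>grad_norm_sq_le_gap\<close> applies.\<close>
lemma convex_smooth_cocoercive: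
  fixes h :: "'a::euclidean_space \<Rightarrow> real"
  assumes cvx: "convex_on UNIV h" and sm: "L_smooth L h" and "L > 0"
  shows "(norm (grad h x - grad h y))\<^sup>2 \<le> 2 * L * (h x - h y - grad h y \<bullet> (x - y))"
proof -
  define p where "p z = h z - grad h y \<bullet> z" for z
  have diff: "h differentiable (at z)" for z using sm by (simp add: L_smooth_def)
  have gp: "GDERIV p z :> grad h z - grad h y" for z
  proof -
    have "(h has_derivative (\<lambda>w. w \<bullet> grad h z)) (at z)"
      using GDERIV_grad[OF diff[of z]] by (simp add: gderiv_def)
    then show ?thesis
      unfolding p_def gderiv_def
      by (auto intro!: derivative_eq_intros simp: inner_diff_right inner_commute)
  qed
  then have grad_p: "grad p z = grad h z - grad h y" for z by (rule grad_eqI)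
  have "L_smooth L p"
    unfolding L_smooth_def
  proof
    show "\<forall>z. p differentiable (at z)" using gp by (auto simp: gderiv_def differentiable_def)
    show "L-lipschitz_on UNIV (grad p)"
      using sm by (auto simp: L_smooth_def lipschitz_on_def grad_p dist_norm)
  qed
  moreover have "p y \<le> p z" for z
    using convex_above_tangent[OF cvx diff[of y], of z] by (simp add: p_def inner_diff_right)
  ultimately have "(norm (grad p x))\<^sup>2 \<le> 2 * L * (p x - p y)"
    using \<open>L > 0\<close> by (intro grad_norm_sq_le_gap) auto
  then show ?thesis by (simp add: grad_p p_def inner_diff_right algebra_simps)
qed

lemma minimizerI:
  assumes "is_arg_min h (\<lambda>_. True) z"
  shows "h (minimizer h) \<le> h x" 
proof -
  have "is_arg_min h (\<lambda>_. True) (minimizer h)"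
    unfolding minimizer_def arg_min_def by (rule someI[where P = "is_arg_min h (\<lambda>_. True)", OF assms])
  then show ?thesis by (auto simp: is_arg_min_def not_less)
qed

lemma grad_minimum_eq_0:
  fixes h :: "'a::euclidean_space \<Rightarrow> real"
  assumes "h differentiable (at z)" "\<And>x. h z \<le> h x"
  shows "grad h z = 0"
proof -
  have "(h has_derivative (\<lambda>y. y \<bullet> grad h z)) (at z)"
    using GDERIV_grad[OF assms(1)] by (simp add: gderiv_def)
  then have "(\<lambda>y. y \<bullet> grad h z) = (\<lambda>y. 0)"
    by (rule has_derivative_local_min) (simp add: assms(2))
  then show ?thesis by (metis inner_eq_zero_iff)
qed

text \<open>Existence of a minimizer comes from quadratic growth: outside a ball of radius \<open>2\<parallel>\<nabla>h(0)\<parallel>/\<mu>\<close>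
  the values exceed \<open>h(0)\<close>, and on the ball the minimum is attained by compactness.\<close>
lemma strongly_convex_imp_quasi:
  fixes h :: "'a::euclidean_space \<Rightarrow> real"
  assumes sc: "strongly_convex \<mu> h" and "\<mu> > 0"
  shows "quasi_strongly_convex \<mu> h"
proof -
  have diff: "h differentiable (at x)" and
    ineq: "h y \<ge> h x + grad h x \<bullet> (y - x) + \<mu> / 2 * (norm (y - x))\<^sup>2" for x y
    using sc by (auto simp: strongly_convex_def)
  have cont: "continuous_on S h" for S
    using diff differentiable_imp_continuous_within continuous_at_imp_continuous_on by blast
  define r where "r = 2 * norm (grad h 0) / \<mu>"
  have "r \<ge> 0" using \<open>\<mu> > 0\<close> by (simp add: r_def)
  obtain z where z: "\<And>y. norm y \<le> r \<Longrightarrow> h z \<le> h y"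
    using continuous_attains_inf[of "cball 0 r" h] cont \<open>r \<ge> 0\<close> by fastforce
  have glob: "h z \<le> h y" for y
  proof (cases "norm y \<le> r")
    case False
    have "norm (grad h 0) * norm y \<le> \<mu> / 2 * (norm y)\<^sup>2"
      using False \<open>\<mu> > 0\<close> mult_right_mono[of "2 * norm (grad h 0)" "\<mu> * norm y" "norm y"]
      unfolding power2_eq_square r_def by (simp add: field_simps)
    moreover have "- (norm (grad h 0) * norm y) \<le> grad h 0 \<bullet> y"
      using Cauchy_Schwarz_ineq2[of "grad h 0" y] by linarith
    ultimately have "h 0 \<le> h y" using ineq[of 0 y] by simp
    then show ?thesis using z[of 0] \<open>r \<ge> 0\<close> by simp
  qed (rule z)
  then have z_min: "is_arg_min h (\<lambda>_. True) z" by (auto simp: is_arg_min_def not_less)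
  have uniq: "w = z" if "is_arg_min h (\<lambda>_. True) w" for w
  proof -
    have w: "h w \<le> h z" using that by (auto simp: is_arg_min_def not_less)
    have "grad h z = 0" by (rule grad_minimum_eq_0[OF diff glob])
    then have "\<mu> / 2 * (norm (w - z))\<^sup>2 \<le> 0" using ineq[of z w] w by simp
    then show ?thesis using \<open>\<mu> > 0\<close> by (simp add: mult_le_0_iff)
  qed
  show ?thesis
    unfolding quasi_strongly_convex_def
  proof
    show "\<exists>!x. is_arg_min h (\<lambda>_. True) x" using z_min uniq by blast
    show "\<forall>x. h x + grad h x \<bullet> (minimizer h - x) + \<mu> / 2 * (norm (x - minimizer h))\<^sup>2
        \<le> h (minimizer h)"
      using ineq by (metis norm_minus_commute)
  qed
qed

lemma quasi_strongly_convex_minimum: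
  assumes "quasi_strongly_convex \<mu> h"
  shows "h (minimizer h) \<le> h x"
  using assms minimizerI unfolding quasi_strongly_convex_def by blast

text \<open>At a point at distance 1 from the minimizer, the quasi strong convexity lower bound on the
  minimum meets the upper bound of the descent lemma.\<close>
lemma quasi_strongly_convex_le_smooth:
  fixes h :: "'a::euclidean_space \<Rightarrow> real"
  assumes qsc: "quasi_strongly_convex \<mu> h" and sm: "L_smooth L h"
  shows "\<mu> \<le> L"
proof -
  obtain b :: 'a where b: "b \<in> Basis" using nonempty_Basis by blast
  define x where "x = minimizer h + b"
  have x: "norm (x - minimizer h) = 1" "norm (minimizer h - x) = 1"
    using b by (auto simp: x_def)
  have "h (minimizer h) \<ge> h x + grad h x \<bullet> (minimizer h - x) + \<mu> / 2 * (norm (x - minimizer h))\<^sup>2"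
    using qsc by (simp add: quasi_strongly_convex_def)
  then show ?thesis using descent_lemma[OF sm, of "minimizer h" x] x by simp
qed

lemma strongly_convex_imp_convex:
  fixes h :: "'a::euclidean_space \<Rightarrow> real"
  assumes sc: "strongly_convex \<mu> h" and "\<mu> \<ge> 0"
  shows "convex_on UNIV h"
proof (rule convex_onI)
  fix t :: real and x y :: 'a
  assume t: "0 < t" "t < 1"
  define z where "z = (1 - t) *\<^sub>R x + t *\<^sub>R y"
  have tan: "h w \<ge> h z + grad h z \<bullet> (w - z)" for w
  proof -
    have "0 \<le> \<mu> / 2 * (norm (w - z))\<^sup>2" using \<open>\<mu> \<ge> 0\<close> by simp
    then show ?thesis using sc unfolding strongly_convex_def by (meson add_increasing2 order_trans dual_order.trans le_add_same_cancel1)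
  qed
  have "(1 - t) * h x + t * h y \<ge>
    (1 - t) * (h z + grad h z \<bullet> (x - z)) + t * (h z + grad h z \<bullet> (y - z))"
    using t by (intro add_mono mult_left_mono tan) auto
  also have "(1 - t) * (h z + grad h z \<bullet> (x - z)) + t * (h z + grad h z \<bullet> (y - z)) =
     h z + grad h z \<bullet> ((1 - t) *\<^sub>R (x - z) + t *\<^sub>R (y - z))"
    by (simp add: inner_simps algebra_simps)
  also have "(1 - t) *\<^sub>R (x - z) + t *\<^sub>R (y - z) = 0"
    by (simp add: z_def algebra_simps)
  finally show "h ((1 - t) *\<^sub>R x + t *\<^sub>R y) \<le> (1 - t) * h x + t * h y" by (simp add: z_def)
qed simp

section \<open>Square integrable vectors, conditional expectation and independence\<close>

definition sq_integrable :: "'o measure \<Rightarrow> ('o \<Rightarrow> 'a::euclidean_space) \<Rightarrow> bool" where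
  "sq_integrable M X \<longleftrightarrow> X \<in> borel_measurable M \<and> integrable M (\<lambda>\<omega>. (norm (X \<omega>))\<^sup>2)"

lemma sq_integrableD:
  assumes "sq_integrable M X"
  shows "X \<in> borel_measurable M" "integrable M (\<lambda>\<omega>. (norm (X \<omega>))\<^sup>2)"
  using assms by (auto simp: sq_integrable_def)

lemma sq_integrable_bound:
  assumes "sq_integrable M Y" "X \<in> borel_measurable M" "AE \<omega> in M. norm (X \<omega>) \<le> c * norm (Y \<omega>)"
  shows "sq_integrable M X"
  unfolding sq_integrable_def
proof
  have "integrable M (\<lambda>\<omega>. c\<^sup>2 * (norm (Y \<omega>))\<^sup>2)"
    using sq_integrableD(2)[OF assms(1)] by simp
  then show "integrable M (\<lambda>\<omega>. (norm (X \<omega>))\<^sup>2)"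
  proof (rule Bochner_Integration.integrable_bound)
    show "AE \<omega> in M. norm ((norm (X \<omega>))\<^sup>2) \<le> norm (c\<^sup>2 * (norm (Y \<omega>))\<^sup>2)"
      using assms(3)
    proof eventually_elim
      case (elim \<omega>)
      then have "(norm (X \<omega>))\<^sup>2 \<le> (c * norm (Y \<omega>))\<^sup>2" by (intro power_mono) auto
      then show ?case by (simp add: power_mult_distrib)
    qed
  qed (use assms(2) in measurable)
qed (rule assms(2))

lemma sq_integrable_add:
  assumes "sq_integrable M X" "sq_integrable M Y"
  shows "sq_integrable M (\<lambda>\<omega>. X \<omega> + Y \<omega>)"
  unfolding sq_integrable_def
proof
  note [measurable] = sq_integrableD(1)[OF assms(1)] sq_integrableD(1)[OF assms(2)]
  show "(\<lambda>\<omega>. X \<omega> + Y \<omega>) \<in> borel_measurable M" by measurable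
  have "integrable M (\<lambda>\<omega>. 2 * (norm (X \<omega>))\<^sup>2 + 2 * (norm (Y \<omega>))\<^sup>2)"
    using sq_integrableD(2)[OF assms(1)] sq_integrableD(2)[OF assms(2)] by simp
  then show "integrable M (\<lambda>\<omega>. (norm (X \<omega> + Y \<omega>))\<^sup>2)"
    by (rule Bochner_Integration.integrable_bound) (use norm_add_sq_le in auto)
qed

lemma sq_integrable_scaleR:
  assumes "sq_integrable M X"
  shows "sq_integrable M (\<lambda>\<omega>. c *\<^sub>R X \<omega>)"
  using sq_integrableD[OF assms] by (auto simp: sq_integrable_def power_mult_distrib)

lemma sq_integrable_diff:
  assumes "sq_integrable M X" "sq_integrable M Y"
  shows "sq_integrable M (\<lambda>\<omega>. X \<omega> - Y \<omega>)"
  using sq_integrable_add[OF assms(1) sq_integrable_scaleR[OF assms(2), of "-1"]] by simp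

lemma sq_integrable_zero: "sq_integrable M (\<lambda>\<omega>. 0)"
  by (simp add: sq_integrable_def)

lemma sq_integrable_sum:
  assumes "\<And>i. i \<in> I \<Longrightarrow> sq_integrable M (X i)"
  shows "sq_integrable M (\<lambda>\<omega>. \<Sum>i\<in>I. X i \<omega>)"
  using assms
  by (induction I rule: infinite_finite_induct) (auto intro: sq_integrable_add sq_integrable_zero)

lemma sq_integrable_average:
  assumes "\<And>i. i < n \<Longrightarrow> sq_integrable M (X i)"
  shows "sq_integrable M (\<lambda>\<omega>. average n (\<lambda>i. X i \<omega>))"
  unfolding average_def using assms by (intro sq_integrable_scaleR sq_integrable_sum) auto

lemma sq_integrable_indicator:
  assumes "sq_integrable M X" "A \<in> sets M"
  shows "sq_integrable M (\<lambda>\<omega>. indicator A \<omega> *\<^sub>R X \<omega>)"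
  by (rule sq_integrable_bound[OF assms(1), where c = 1])
     (use assms sq_integrableD(1)[OF assms(1)] in \<open>auto simp: indicator_def\<close>)

lemma integrable_inner_sq:
  assumes "sq_integrable M X" "sq_integrable M Y"
  shows "integrable M (\<lambda>\<omega>. X \<omega> \<bullet> Y \<omega>)"
proof -
  note [measurable] = sq_integrableD(1)[OF assms(1)] sq_integrableD(1)[OF assms(2)]
  have "integrable M (\<lambda>\<omega>. (norm (X \<omega>))\<^sup>2 + (norm (Y \<omega>))\<^sup>2)"
    using sq_integrableD(2)[OF assms(1)] sq_integrableD(2)[OF assms(2)] by simp
  then show ?thesis
  proof (rule Bochner_Integration.integrable_bound)
    have "\<bar>X \<omega> \<bullet> Y \<omega>\<bar> \<le> (norm (X \<omega>))\<^sup>2 + (norm (Y \<omega>))\<^sup>2" for \<omega>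
    proof -
      have "2 * (norm (X \<omega>) * norm (Y \<omega>)) \<le> (norm (X \<omega>))\<^sup>2 + (norm (Y \<omega>))\<^sup>2"
        using sum_squares_bound[of "norm (X \<omega>)" "norm (Y \<omega>)"] by (simp add: mult.assoc)
      moreover have "0 \<le> norm (X \<omega>) * norm (Y \<omega>)" by simp
      ultimately show ?thesis using Cauchy_Schwarz_ineq2[of "X \<omega>" "Y \<omega>"] by linarith
    qed
    then show "AE \<omega> in M. norm (X \<omega> \<bullet> Y \<omega>) \<le> norm ((norm (X \<omega>))\<^sup>2 + (norm (Y \<omega>))\<^sup>2)" by auto
  qed measurable
qed

lemma (in finite_measure) sq_integrable_const: "sq_integrable M (\<lambda>\<omega>. c)"
  by (simp add: sq_integrable_def)

lemma (in finite_measure) sq_integrable_imp_integrable: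
  assumes "sq_integrable M X"
  shows "integrable M X"
proof -
  have "integrable M (\<lambda>\<omega>. 1 + (norm (X \<omega>))\<^sup>2)" using sq_integrableD(2)[OF assms] by simp
  then show ?thesis
  proof (rule Bochner_Integration.integrable_bound)
    have "norm (X \<omega>) \<le> 1 + (norm (X \<omega>))\<^sup>2" for \<omega>
      using sum_squares_bound[of 1 "norm (X \<omega>)"] norm_ge_zero[of "X \<omega>"]
      unfolding power_one mult_1_right by linarith
    then show "AE \<omega> in M. norm (X \<omega>) \<le> norm (1 + (norm (X \<omega>))\<^sup>2)" by simp
  qed (rule sq_integrableD(1)[OF assms])
qed

lemma integral_norm_sq_sum_orthogonal:
  fixes X :: "'i \<Rightarrow> 'o \<Rightarrow> 'a::euclidean_space"
  assumes "finite I" and sq: "\<And>i. i \<in> I \<Longrightarrow> sq_integrable M (X i)"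
    and orth: "\<And>i j. i \<in> I \<Longrightarrow> j \<in> I \<Longrightarrow> i \<noteq> j \<Longrightarrow> (\<integral>\<omega>. X i \<omega> \<bullet> X j \<omega> \<partial>M) = 0"
  shows "(\<integral>\<omega>. (norm (\<Sum>i\<in>I. X i \<omega>))\<^sup>2 \<partial>M) = (\<Sum>i\<in>I. \<integral>\<omega>. (norm (X i \<omega>))\<^sup>2 \<partial>M)"
proof -
  have "(norm (\<Sum>i\<in>I. X i \<omega>))\<^sup>2 = (\<Sum>i\<in>I. \<Sum>j\<in>I. X i \<omega> \<bullet> X j \<omega>)" for \<omega>
    unfolding power2_norm_eq_inner inner_sum_left inner_sum_right by (rule sum.swap)
  then have "(\<integral>\<omega>. (norm (\<Sum>i\<in>I. X i \<omega>))\<^sup>2 \<partial>M) = (\<integral>\<omega>. (\<Sum>i\<in>I. \<Sum>j\<in>I. X i \<omega> \<bullet> X j \<omega>) \<partial>M)"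
    by simp
  also have "\<dots> = (\<Sum>i\<in>I. \<Sum>j\<in>I. \<integral>\<omega>. X i \<omega> \<bullet> X j \<omega> \<partial>M)"
    using sq by (simp add: Bochner_Integration.integral_sum Bochner_Integration.integrable_sum
        integrable_inner_sq)
  also have "\<dots> = (\<Sum>i\<in>I. \<Sum>j\<in>I. if j = i then \<integral>\<omega>. (norm (X i \<omega>))\<^sup>2 \<partial>M else 0)"
    using orth by (intro sum.cong refl) (auto simp: power2_norm_eq_inner)
  finally show ?thesis using \<open>finite I\<close> by simp
qed

text \<open>The conditional expectation cannot exceed \<open>h\<close> on a set of positive measure, since this set
  belongs to \<open>F\<close> and the hypothesis bounds the integral over it.\<close>
lemma (in sigma_finite_subalgebra) real_cond_exp_le:
  assumes le: "\<And>A. A \<in> sets F \<Longrightarrow> (\<integral>x\<in>A. u x \<partial>M) \<le> (\<integral>x\<in>A. h x \<partial>M)"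
    and [measurable]: "integrable M u" "integrable M h" "h \<in> borel_measurable F"
  shows "AE x in M. real_cond_exp M F u x \<le> h x"
proof -
  let ?c = "real_cond_exp M F u"
  define A where "A = {x \<in> space F. h x < ?c x}"
  have A[measurable]: "A \<in> sets F" unfolding A_def by measurable
  then have AM[measurable]: "A \<in> sets M" using subalg by (auto simp: subalgebra_def)
  have ic: "integrable M ?c" by (rule real_cond_exp_int) fact
  have i1: "integrable M (\<lambda>x. indicator A x * (?c x - h x))"
    using integrable_mult_indicator[OF AM Bochner_Integration.integrable_diff[OF ic assms(3)]] by simp
  have s1: "set_integrable M A ?c" "set_integrable M A h"
    using ic assms(3) AM unfolding set_integrable_def by (blast intro: integrable_mult_indicator)+
  have "(\<integral>x. indicator A x * (?c x - h x) \<partial>M) = (\<integral>x\<in>A. ?c x \<partial>M) - (\<integral>x\<in>A. h x \<partial>M)"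
    using set_integral_diff(2)[OF s1] by (simp add: set_lebesgue_integral_def)
  also have "\<dots> = (\<integral>x\<in>A. u x \<partial>M) - (\<integral>x\<in>A. h x \<partial>M)"
    using real_cond_exp_intA[OF assms(2) A] by simp
  also have "\<dots> \<le> 0" using le[OF A] by simp
  finally have "(\<integral>x. indicator A x * (?c x - h x) \<partial>M) \<le> 0" .
  moreover have pos: "0 \<le> indicator A x * (?c x - h x)" for x
    by (auto simp: indicator_def A_def)
  ultimately have "(\<integral>x. indicator A x * (?c x - h x) \<partial>M) = 0"
    by (simp add: antisym)
  then have "AE x in M. indicator A x * (?c x - h x) = 0"
    using integral_nonneg_eq_0_iff_AE[OF i1] pos by simp
  then show ?thesis
    using AE_space
  proof eventually_elim
    case (elim x)
    then have "x \<in> space F" using subalg by (simp add: subalgebra_def)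
    with elim show ?case by (auto simp: A_def indicator_def split: if_splits)
  qed
qed

text \<open>Independence makes the joint law of \<open>X\<close> and \<open>Y\<close> a product measure, and Fubini then
  integrates over \<open>X\<close> first. Stating independence through probabilities of events lets \<open>X\<close> and \<open>Y\<close>
  have values of different types.\<close>
lemma (in prob_space) integral_independent_pair:
  fixes \<phi> :: "'b \<Rightarrow> 'c \<Rightarrow> real"
  assumes [measurable]: "random_variable S X" "random_variable T Y"
    and ind: "\<And>A B. A \<in> sets S \<Longrightarrow> B \<in> sets T \<Longrightarrow>
      prob ((X -` A \<inter> space M) \<inter> (Y -` B \<inter> space M)) = prob (X -` A \<inter> space M) * prob (Y -` B \<inter> space M)"
    and [measurable]: "(\<lambda>(s, y). \<phi> s y) \<in> borel_measurable (S \<Otimes>\<^sub>M T)"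
    and int: "integrable M (\<lambda>\<omega>. \<phi> (X \<omega>) (Y \<omega>))"
  shows "integrable M (\<lambda>\<omega>. \<integral>s. \<phi> s (Y \<omega>) \<partial>distr M S X)"
    and "(\<integral>\<omega>. \<phi> (X \<omega>) (Y \<omega>) \<partial>M) = (\<integral>\<omega>. (\<integral>s. \<phi> s (Y \<omega>) \<partial>distr M S X) \<partial>M)"
proof -
  interpret X: prob_space "distr M S X" by (rule prob_space_distr) measurable
  interpret Y: prob_space "distr M T Y" by (rule prob_space_distr) measurable
  interpret XY: pair_sigma_finite "distr M S X" "distr M T Y" ..
  have eq: "distr M S X \<Otimes>\<^sub>M distr M T Y = distr M (S \<Otimes>\<^sub>M T) (\<lambda>x. (X x, Y x))"
  proof (rule pair_measure_eqI)
    fix A B assume "A \<in> sets (distr M S X)" "B \<in> sets (distr M T Y)"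
    then have [measurable]: "A \<in> sets S" "B \<in> sets T" by auto
    have "(\<lambda>x. (X x, Y x)) -` (A \<times> B) \<inter> space M = (X -` A \<inter> space M) \<inter> (Y -` B \<inter> space M)"
      by auto
    then show "emeasure (distr M S X) A * emeasure (distr M T Y) B
        = emeasure (distr M (S \<Otimes>\<^sub>M T) (\<lambda>x. (X x, Y x))) (A \<times> B)"
      using ind[of A B] by (simp add: emeasure_distr emeasure_eq_measure ennreal_mult)
  qed (auto intro: X.sigma_finite_measure_axioms Y.sigma_finite_measure_axioms)
  have int': "integrable (distr M S X \<Otimes>\<^sub>M distr M T Y) (case_prod \<phi>)"
    unfolding eq using int by (subst integrable_distr_eq) auto
  have [measurable]: "(\<lambda>y. \<integral>s. \<phi> s y \<partial>distr M S X) \<in> borel_measurable T"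
    by (rule X.borel_measurable_lebesgue_integral[of "\<lambda>y s. \<phi> s y"]) measurable
  show "integrable M (\<lambda>\<omega>. \<integral>s. \<phi> s (Y \<omega>) \<partial>distr M S X)"
    using XY.integrable_snd[OF int'] by (subst (asm) integrable_distr_eq) auto
  have "(\<integral>\<omega>. \<phi> (X \<omega>) (Y \<omega>) \<partial>M) = integral\<^sup>L (distr M S X \<Otimes>\<^sub>M distr M T Y) (case_prod \<phi>)"
    unfolding eq by (subst integral_distr) auto
  also have "\<dots> = (\<integral>y. (\<integral>s. \<phi> s y \<partial>distr M S X) \<partial>distr M T Y)"
    using XY.integral_snd[OF int'] by simp
  also have "\<dots> = (\<integral>\<omega>. (\<integral>s. \<phi> s (Y \<omega>) \<partial>distr M S X) \<partial>M)"
    by (subst integral_distr) auto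
  finally show "(\<integral>\<omega>. \<phi> (X \<omega>) (Y \<omega>) \<partial>M) = (\<integral>\<omega>. (\<integral>s. \<phi> s (Y \<omega>) \<partial>distr M S X) \<partial>M)" .
qed

lemma integrable_average:
  fixes X :: "nat \<Rightarrow> 'o \<Rightarrow> real"
  assumes "\<And>i. i < n \<Longrightarrow> integrable M (X i)"
  shows "integrable M (\<lambda>\<omega>. average n (\<lambda>i. X i \<omega>))"
  unfolding average_def
  by (intro integrable_scaleR_right Bochner_Integration.integrable_sum assms) simp

lemma integral_average:
  fixes X :: "nat \<Rightarrow> 'o \<Rightarrow> real"
  assumes "\<And>i. i < n \<Longrightarrow> integrable M (X i)"
  shows "(\<integral>\<omega>. average n (\<lambda>i. X i \<omega>) \<partial>M) = average n (\<lambda>i. \<integral>\<omega>. X i \<omega> \<partial>M)"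
  using assms by (simp add: average_def)

section \<open>Exponential weights\<close>

lemma weight_pos: "\<eta> < 1 \<Longrightarrow> weight \<eta> k > 0"
  by (simp add: weight_def)

lemma total_weight_pos: "\<eta> < 1 \<Longrightarrow> total_weight \<eta> K > 0"
  unfolding total_weight_def by (intro sum_pos weight_pos) auto

text \<open>By Bernoulli's inequality, \<open>(1 - \<eta>)\<^sup>k\<^sup>-\<^sup>t \<ge> 1 - \<tau> \<eta> \<ge> 3/4\<close>.\<close>
lemma weight_le_within_delay:
  assumes "0 \<le> \<eta>" "real \<tau> * \<eta> \<le> 1 / 4" "t < k" "k \<le> t + \<tau>"
  shows "weight \<eta> k \<le> 4 / 3 * weight \<eta> t"
proof -
  have "1 * \<eta> \<le> real \<tau> * \<eta>" using assms by (intro mult_right_mono) auto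
  then have eta: "\<eta> \<le> 1 / 4" using assms by simp
  have "real (k - t) * \<eta> \<le> real \<tau> * \<eta>" using assms by (intro mult_right_mono) auto
  then have "3 / 4 \<le> 1 + real (k - t) * - \<eta>" using assms by simp
  also have "\<dots> \<le> (1 + - \<eta>) ^ (k - t)" using eta by (intro Bernoulli_inequality) simp
  finally have *: "3 / 4 \<le> (1 - \<eta>) ^ (k - t)" by simp
  have "k + 1 = (t + 1) + (k - t)" using assms by simp
  then have "(1 - \<eta>) ^ (k + 1) = (1 - \<eta>) ^ (t + 1) * (1 - \<eta>) ^ (k - t)"
    by (metis power_add)
  also have "\<dots> \<ge> (1 - \<eta>) ^ (t + 1) * (3 / 4)"
    using * eta by (intro mult_left_mono) auto
  finally have "inverse ((1 - \<eta>) ^ (k + 1)) \<le> inverse ((1 - \<eta>) ^ (t + 1) * (3 / 4))"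
    using eta by (intro le_imp_inverse_le) auto
  then show ?thesis unfolding weight_def inverse_mult_distrib by simp
qed

text \<open>After exchanging the two sums, each \<open>a t\<close> occurs in at most \<open>\<tau>\<close> windows, whose weights are
  comparable to the weight of \<open>t\<close>.\<close>
lemma weighted_window_sum_le:
  fixes a :: "nat \<Rightarrow> real"
  assumes "0 \<le> \<eta>" "\<eta> < 1" "real \<tau> * \<eta> \<le> 1 / 4" and a: "\<And>t. 0 \<le> a t"
  shows "(\<Sum>k\<le>K. weight \<eta> k * (\<Sum>t\<in>{k - \<tau>..<k}. a t))
    \<le> 4 / 3 * real \<tau> * (\<Sum>t\<le>K. weight \<eta> t * a t)"
proof -
  define c where "c t = 4 / 3 * weight \<eta> t * a t" for t
  have c: "0 \<le> c t" for t using a weight_pos[OF assms(2)] by (simp add: c_def less_imp_le)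
  have "(\<Sum>k\<le>K. weight \<eta> k * (\<Sum>t\<in>{k - \<tau>..<k}. a t)) \<le> (\<Sum>k\<le>K. \<Sum>t\<in>{k - \<tau>..<k}. c t)"
    unfolding sum_distrib_left c_def
    using assms by (intro sum_mono mult_right_mono weight_le_within_delay a) auto
  also have "\<dots> = (\<Sum>k\<in>{..K}. \<Sum>t\<in>{t. t \<in> {..K} \<and> (t < k \<and> k \<le> t + \<tau>)}. c t)"
    by (intro sum.cong refl) auto
  also have "\<dots> = (\<Sum>t\<in>{..K}. \<Sum>k\<in>{k. k \<in> {..K} \<and> (t < k \<and> k \<le> t + \<tau>)}. c t)"
    by (rule sum.swap_restrict) auto
  also have "\<dots> \<le> (\<Sum>t\<le>K. real \<tau> * c t)"
  proof (rule sum_mono)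
    fix t
    have "card {k. k \<in> {..K} \<and> (t < k \<and> k \<le> t + \<tau>)} \<le> card {t<..t + \<tau>}"
      by (rule card_mono) auto
    then show "(\<Sum>k\<in>{k. k \<in> {..K} \<and> (t < k \<and> k \<le> t + \<tau>)}. c t) \<le> real \<tau> * c t"
      using c by (simp add: mult_right_mono)
  qed
  also have "\<dots> = 4 / 3 * real \<tau> * (\<Sum>t\<le>K. weight \<eta> t * a t)"
    by (simp add: sum_distrib_left c_def mult_ac)
  finally show ?thesis .
qed

text \<open>The weights are chosen so that \<open>w\<^sub>k (1 - \<eta>) = w\<^sub>k\<^sub>-\<^sub>1\<close>.\<close>
lemma weighted_telescope:
  assumes "\<eta> < 1"
  shows "(\<Sum>k\<le>K. weight \<eta> k * ((1 - \<eta>) * r k - r (Suc k))) = r 0 - weight \<eta> K * r (Suc K)"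
proof (induction K)
  case 0
  then show ?case using assms by (simp add: weight_def field_simps)
next
  case (Suc K)
  have "weight \<eta> (Suc K) * (1 - \<eta>) = weight \<eta> K"
  proof -
    have "inverse (q ^ Suc (K + 1)) * q = inverse (q ^ (K + 1))" if "q \<noteq> 0" for q :: real
      using that by (simp add: field_simps)
    from this[of "1 - \<eta>"] show ?thesis using assms by (simp add: weight_def)
  qed
  then have "weight \<eta> (Suc K) * ((1 - \<eta>) * r (Suc K)) = weight \<eta> K * r (Suc K)"
    by (simp add: mult.assoc[symmetric])
  then show ?case using Suc.IH by (simp add: right_diff_distrib)
qed

text \<open>Half of the coefficient \<open>\<gamma>/2\<close> of the gap \<open>d\<close> is spent on absorbing the gap terms in the
  bound on the errors \<open>E\<close>; the other half remains.\<close>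
lemma weighted_recursion_bound:
  fixes r d E :: "nat \<Rightarrow> real"
  assumes "\<eta> < 1" "0 < \<gamma>" "\<And>k. 0 \<le> r k"
    and rec: "\<And>k. \<gamma> / 2 * d k \<le> (1 - \<eta>) * r k - r (Suc k) + 3 * L * \<gamma> * E k + \<gamma>\<^sup>2 * B"
    and err: "3 * L * (\<Sum>k\<le>K. weight \<eta> k * E k)
      \<le> 1 / 4 * (\<Sum>k\<le>K. weight \<eta> k * d k) + \<gamma> * C * total_weight \<eta> K"
  shows "(\<Sum>k\<le>K. weight \<eta> k * d k) \<le> 4 * r 0 / \<gamma> + 4 * \<gamma> * (B + C) * total_weight \<eta> K"
proof -
  let ?w = "weight \<eta>" and ?W = "total_weight \<eta> K"
  let ?S = "\<Sum>k\<le>K. ?w k * d k"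
  have "\<gamma> / 2 * ?S = (\<Sum>k\<le>K. ?w k * (\<gamma> / 2 * d k))" by (simp add: sum_distrib_left mult_ac)
  also have "\<dots> \<le> (\<Sum>k\<le>K. ?w k * ((1 - \<eta>) * r k - r (Suc k) + 3 * L * \<gamma> * E k + \<gamma>\<^sup>2 * B))"
    using weight_pos[OF assms(1)] by (intro sum_mono mult_left_mono rec) (simp add: less_imp_le)
  also have "\<dots> = (\<Sum>k\<le>K. ?w k * ((1 - \<eta>) * r k - r (Suc k)))
      + \<gamma> * (3 * L * (\<Sum>k\<le>K. ?w k * E k)) + \<gamma>\<^sup>2 * B * ?W"
    by (simp add: distrib_left sum.distrib sum_distrib_left sum_distrib_right total_weight_def mult_ac)
  also have "\<dots> \<le> r 0 + \<gamma> * (1 / 4 * ?S + \<gamma> * C * ?W) + \<gamma>\<^sup>2 * B * ?W"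
    using weighted_telescope[OF assms(1), of r K] weight_pos[OF assms(1), of K] assms(2,3)
    by (intro add_mono[OF add_mono[OF _ mult_left_mono[OF err]] order_refl]) (auto simp: less_imp_le)
  finally have "\<gamma> * ?S \<le> 4 * r 0 + \<gamma> * (4 * \<gamma> * (B + C) * ?W)"
    by (simp add: algebra_simps power2_eq_square)
  then have "?S \<le> (4 * r 0 + \<gamma> * (4 * \<gamma> * (B + C) * ?W)) / \<gamma>"
    using assms(2) by (simp add: pos_le_divide_eq mult.commute)
  then show ?thesis using assms(2) by (simp add: add_divide_distrib)
qed

section \<open>The finite-sum objective\<close>

context stochastic_finite_sum
begin

abbreviation f where "f \<equiv> objective n D F"
abbreviation xs where "xs \<equiv> minimizer f"
abbreviation loss where "loss \<equiv> local_loss D F"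

lemma sample_grad_lipschitz:
  assumes "i < n"
  shows "AE s in D i. \<forall>x y. norm (grad (F i s) x - grad (F i s) y) \<le> L * norm (x - y)"
  using smooth[OF assms]
  by eventually_elim (auto simp: L_smooth_def lipschitz_on_def dist_norm)

lemma loss_grad_lipschitz:
  assumes i: "i < n"
  shows "norm (grad (loss i) x - grad (loss i) y) \<le> L * norm (x - y)"
proof -
  interpret prob_space "D i" by (rule prob_D[OF i])
  have "norm (grad (loss i) x - grad (loss i) y) = norm (\<integral>s. grad (F i s) x - grad (F i s) y \<partial>D i)"
    using grad_integrable[OF i] by (simp add: grad_unbiased[OF i])
  also have "\<dots> \<le> (\<integral>s. norm (grad (F i s) x - grad (F i s) y) \<partial>D i)"
    by (rule integral_norm_bound)
  also have "\<dots> \<le> (\<integral>s. L * norm (x - y) \<partial>D i)"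
    using sample_grad_lipschitz[OF i] grad_integrable[OF i]
    by (intro integral_mono_AE) (auto intro!: integrable_norm Bochner_Integration.integrable_diff)
  finally show ?thesis by (simp add: prob_space)
qed

lemma GDERIV_objective: "GDERIV f x :> average n (\<lambda>i. grad (loss i) x)"
proof -
  have "(loss i has_derivative (\<lambda>y. y \<bullet> grad (loss i) x)) (at x)" if "i < n" for i
    using GDERIV_grad[OF local_loss_differentiable[OF that, of x]] by (simp add: gderiv_def)
  then have "((\<lambda>y. (1 / real n) * (\<Sum>i<n. loss i y)) has_derivative
      (\<lambda>y. (1 / real n) * (\<Sum>i<n. y \<bullet> grad (loss i) x))) (at x)"
    by (intro derivative_intros has_derivative_mult_right has_derivative_sum) auto
  then show ?thesis
    unfolding gderiv_def
    by (simp add: objective_def[abs_def] average_def inner_sum_right)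
qed

lemma grad_objective: "grad f x = average n (\<lambda>i. grad (loss i) x)"
  by (rule grad_eqI[OF GDERIV_objective])

lemma objective_smooth: "L_smooth L f"
  unfolding L_smooth_def
proof
  show "\<forall>x. f differentiable (at x)"
    using GDERIV_objective by (auto simp: gderiv_def differentiable_def)
  show "L-lipschitz_on UNIV (grad f)"
  proof (rule lipschitz_onI)
    fix x y
    have "grad f x - grad f y = (1 / real n) *\<^sub>R (\<Sum>i<n. grad (loss i) x - grad (loss i) y)"
      unfolding grad_objective average_def sum_subtractf scaleR_diff_right by (rule refl)
    then have "norm (grad f x - grad f y) = 1 / real n * norm (\<Sum>i<n. grad (loss i) x - grad (loss i) y)"
      by simp
    also have "\<dots> \<le> 1 / real n * (\<Sum>i<n. L * norm (x - y))"
      using loss_grad_lipschitz by (intro mult_left_mono sum_norm_le) auto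
    also have "\<dots> = L * norm (x - y)" using n_pos by simp
    finally show "dist (grad f x) (grad f y) \<le> L * dist x y" by (simp add: dist_norm)
  qed (use L_pos in simp)
qed

lemma objective_differentiable: "f differentiable (at x)"
  using objective_smooth by (simp add: L_smooth_def)

lemma objective_continuous: "continuous_on S f"
  using objective_differentiable differentiable_imp_continuous_within
    continuous_at_imp_continuous_on by blast

lemma objective_borel[measurable]: "f \<in> borel_measurable borel"
  by (rule borel_measurable_continuous_onI[OF objective_continuous])

lemma grad_objective_borel[measurable]: "grad f \<in> borel_measurable borel"
  using objective_smooth lipschitz_on_continuous_on
  by (intro borel_measurable_continuous_onI) (auto simp: L_smooth_def)

lemma loss_grad_borel[measurable]:
  assumes "i < n"
  shows "grad (loss i) \<in> borel_measurable borel"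
proof (rule borel_measurable_continuous_onI)
  have "L-lipschitz_on UNIV (grad (loss i))"
    using loss_grad_lipschitz[OF assms] L_pos by (auto simp: lipschitz_on_def dist_norm)
  then show "continuous_on UNIV (grad (loss i))" by (rule lipschitz_on_continuous_on)
qed

lemma sample_grad_measurable[measurable]:
  assumes "i < n"
  shows "(\<lambda>s. grad (F i s) x) \<in> borel_measurable (D i)"
  using borel_measurable_integrable[OF grad_integrable[OF assms]] .

definition variance_at_min :: real where
  "variance_at_min = (\<Sum>i<n. grad_var D F i xs)"

lemma variance_at_min_nonneg: "0 \<le> variance_at_min"
  unfolding variance_at_min_def grad_var_def by (intro sum_nonneg) simp

text \<open>The constant \<open>\<kappa>\<close> is 1 for convex samples and the condition number in the strongly convex
  case.\<close>
definition sample_grad_growth :: "real \<Rightarrow> bool" where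
  "sample_grad_growth \<kappa> \<longleftrightarrow>
    (\<forall>y. average n (\<lambda>i. \<integral>s. (norm (grad (F i s) y - grad (F i s) xs))\<^sup>2 \<partial>D i)
      \<le> 2 * \<kappa> * L * (f y - f xs))"

lemma integrable_sample_grad_diff_sq:
  assumes "i < n"
  shows "integrable (D i) (\<lambda>s. (norm (grad (F i s) y - grad (F i s) xs))\<^sup>2)"
proof -
  interpret prob_space "D i" by (rule prob_D[OF assms])
  note [measurable] = sample_grad_measurable[OF assms]
  have "AE s in D i. norm ((norm (grad (F i s) y - grad (F i s) xs))\<^sup>2) \<le> norm ((L * norm (y - xs))\<^sup>2)"
    using sample_grad_lipschitz[OF assms]
    by eventually_elim (auto intro!: power_mono)
  with _ _ show ?thesis
  proof (rule Bochner_Integration.integrable_bound)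
    show "integrable (D i) (\<lambda>_. (L * norm (y - xs))\<^sup>2)" by (rule integrable_const)
  qed measurable
qed

text \<open>Cocoercivity of each sample is integrated over the samples and averaged over the workers;
  the linear term that remains is \<open>\<nabla>f(x\<^sup>*)\<close>, which vanishes.\<close>
lemma sample_grad_growth_convex:
  assumes cvx: "\<And>i s. i < n \<Longrightarrow> s \<in> space (D i) \<Longrightarrow> convex_on UNIV (F i s)"
    and min: "grad f xs = 0"
  shows "sample_grad_growth 1"
  unfolding sample_grad_growth_def
proof
  fix y
  have "(\<integral>s. (norm (grad (F i s) y - grad (F i s) xs))\<^sup>2 \<partial>D i)
      \<le> 2 * L * (loss i y - loss i xs - grad (loss i) xs \<bullet> (y - xs))" if i: "i < n" for i
  proof -
    have "AE s in D i. (norm (grad (F i s) y - grad (F i s) xs))\<^sup>2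
        \<le> 2 * L * (F i s y - F i s xs - grad (F i s) xs \<bullet> (y - xs))"
      using smooth[OF i] AE_space
    proof eventually_elim
      case (elim s)
      then show ?case using convex_smooth_cocoercive[OF cvx[OF i]] L_pos by blast
    qed
    then have "(\<integral>s. (norm (grad (F i s) y - grad (F i s) xs))\<^sup>2 \<partial>D i)
        \<le> (\<integral>s. 2 * L * (F i s y - F i s xs - grad (F i s) xs \<bullet> (y - xs)) \<partial>D i)"
      using loss_integrable[OF i] grad_integrable[OF i]
      by (intro integral_mono_AE integrable_sample_grad_diff_sq i) auto
    also have "\<dots> = 2 * L * ((\<integral>s. F i s y \<partial>D i) - (\<integral>s. F i s xs \<partial>D i)
        - (\<integral>s. grad (F i s) xs \<partial>D i) \<bullet> (y - xs))"
      using loss_integrable[OF i] grad_integrable[OF i] by simp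
    also have "\<dots> = 2 * L * (loss i y - loss i xs - grad (loss i) xs \<bullet> (y - xs))"
      unfolding grad_unbiased[OF i] by (simp add: local_loss_def)
    finally show ?thesis .
  qed
  then have "average n (\<lambda>i. \<integral>s. (norm (grad (F i s) y - grad (F i s) xs))\<^sup>2 \<partial>D i)
      \<le> average n (\<lambda>i. 2 * L * (loss i y - loss i xs - grad (loss i) xs \<bullet> (y - xs)))"
    unfolding average_def by (intro scaleR_left_mono sum_mono) auto
  also have "\<dots> = 2 * L * (f y - f xs - grad f xs \<bullet> (y - xs))"
    unfolding grad_objective objective_def average_def
    by (simp add: sum_subtractf inner_sum_left right_diff_distrib diff_divide_distrib
        flip: sum_distrib_left)
  finally show "average n (\<lambda>i. \<integral>s. (norm (grad (F i s) y - grad (F i s) xs))\<^sup>2 \<partial>D i)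
      \<le> 2 * 1 * L * (f y - f xs)" by (simp add: min)
qed

lemma objective_strongly_convex:
  assumes "\<And>i. i < n \<Longrightarrow> strongly_convex \<mu> (loss i)"
  shows "strongly_convex \<mu> f"
  unfolding strongly_convex_def
proof (intro conjI allI)
  fix x y
  have "(\<Sum>i<n. loss i x + grad (loss i) x \<bullet> (y - x) + \<mu> / 2 * (norm (y - x))\<^sup>2) \<le> (\<Sum>i<n. loss i y)"
    using assms by (intro sum_mono) (auto simp: strongly_convex_def)
  then have "1 / real n * (\<Sum>i<n. loss i x + grad (loss i) x \<bullet> (y - x) + \<mu> / 2 * (norm (y - x))\<^sup>2)
      \<le> 1 / real n * (\<Sum>i<n. loss i y)"
    by (intro mult_left_mono) auto
  then show "f y \<ge> f x + grad f x \<bullet> (y - x) + \<mu> / 2 * (norm (y - x))\<^sup>2"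
    using n_pos unfolding grad_objective objective_def average_def
    by (simp add: sum.distrib inner_sum_left add_divide_distrib distrib_left)
qed (rule objective_differentiable)

text \<open>For samples that are not convex, the Lipschitz bound \<open>L\<^sup>2 \<parallel>y - x\<^sup>*\<parallel>\<^sup>2\<close> is all there is;
  quadratic growth of \<open>f\<close> converts it into the gap at the price of a factor \<open>L/\<mu>\<close>.\<close>
lemma sample_grad_growth_strongly_convex:
  assumes sc: "strongly_convex \<mu> f" and "\<mu> > 0" and min: "grad f xs = 0"
  shows "sample_grad_growth (L / \<mu>)"
  unfolding sample_grad_growth_def
proof
  fix y
  have "(\<integral>s. (norm (grad (F i s) y - grad (F i s) xs))\<^sup>2 \<partial>D i) \<le> (L * norm (y - xs))\<^sup>2"
    if i: "i < n" for i
  proof -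
    interpret prob_space "D i" by (rule prob_D[OF i])
    have "AE s in D i. (norm (grad (F i s) y - grad (F i s) xs))\<^sup>2 \<le> (L * norm (y - xs))\<^sup>2"
      using sample_grad_lipschitz[OF i] by eventually_elim (auto intro!: power_mono)
    then have "(\<integral>s. (norm (grad (F i s) y - grad (F i s) xs))\<^sup>2 \<partial>D i)
        \<le> (\<integral>s. (L * norm (y - xs))\<^sup>2 \<partial>D i)"
      by (intro integral_mono_AE integrable_sample_grad_diff_sq i) auto
    then show ?thesis by (simp add: prob_space)
  qed
  then have "average n (\<lambda>i. \<integral>s. (norm (grad (F i s) y - grad (F i s) xs))\<^sup>2 \<partial>D i)
      \<le> average n (\<lambda>i. (L * norm (y - xs))\<^sup>2)"
    unfolding average_def by (intro scaleR_left_mono sum_mono) auto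
  also have "\<dots> = L\<^sup>2 * (norm (y - xs))\<^sup>2"
    using n_pos by (simp add: average_def power_mult_distrib)
  also have "\<dots> = 2 * (L / \<mu>) * L * (\<mu> / 2 * (norm (y - xs))\<^sup>2)"
    using \<open>\<mu> > 0\<close> by (simp add: power2_eq_square)
  also have "\<dots> \<le> 2 * (L / \<mu>) * L * (f y - f xs)"
  proof (rule mult_left_mono)
    have "f y \<ge> f xs + grad f xs \<bullet> (y - xs) + \<mu> / 2 * (norm (y - xs))\<^sup>2"
      using sc by (simp add: strongly_convex_def)
    then show "\<mu> / 2 * (norm (y - xs))\<^sup>2 \<le> f y - f xs" by (simp add: min)
  qed (use L_pos \<open>\<mu> > 0\<close> in simp)
  finally show "average n (\<lambda>i. \<integral>s. (norm (grad (F i s) y - grad (F i s) xs))\<^sup>2 \<partial>D i)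
      \<le> 2 * (L / \<mu>) * L * (f y - f xs)" .
qed

lemma objective_convex:
  assumes cvx: "\<And>i s. i < n \<Longrightarrow> s \<in> space (D i) \<Longrightarrow> convex_on UNIV (F i s)"
  shows "convex_on UNIV f"
proof (rule convex_onI)
  fix t :: real and x y
  assume t: "0 < t" "t < 1"
  have "loss i ((1 - t) *\<^sub>R x + t *\<^sub>R y) \<le> (1 - t) * loss i x + t * loss i y" if i: "i < n" for i
  proof -
    have "loss i ((1 - t) *\<^sub>R x + t *\<^sub>R y) \<le> (\<integral>s. (1 - t) * F i s x + t * F i s y \<partial>D i)"
      unfolding local_loss_def
      using t loss_integrable[OF i] by (intro integral_mono convex_onD[OF cvx[OF i]]) auto
    also have "\<dots> = (1 - t) * loss i x + t * loss i y"
      using loss_integrable[OF i] by (simp add: local_loss_def)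
    finally show ?thesis .
  qed
  then have "f ((1 - t) *\<^sub>R x + t *\<^sub>R y) \<le> average n (\<lambda>i. (1 - t) * loss i x + t * loss i y)"
    unfolding objective_def average_def by (intro scaleR_left_mono sum_mono) auto
  also have "\<dots> = (1 - t) * f x + t * f y"
    by (simp add: objective_def average_def sum.distrib add_divide_distrib flip: sum_distrib_left)
  finally show "f ((1 - t) *\<^sub>R x + t *\<^sub>R y) \<le> (1 - t) * f x + t * f y" .
qed simp

end

section \<open>Filtration, independence and decomposition of the stochastic gradient\<close>

context delayed_sgd
begin

text \<open>Besides the past of a step, the index sets include the past together with another sample of
  the same step, which gives the orthogonality of different workers.\<close>
definition samples :: "(nat \<times> nat) set \<Rightarrow> 'o measure" where
  "samples J = sigma (space M) (\<Union>(i, t)\<in>J. {\<xi> i t -` A \<inter> space M | A. A \<in> sets (D i)})"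

abbreviation past :: "nat \<Rightarrow> (nat \<times> nat) set" where
  "past k \<equiv> {..<n} \<times> {..<k}"

lemma history_eq_samples: "history M n D \<xi> k = samples (past k)"
proof -
  have "(\<Union>i<n. \<Union>t<k. {\<xi> i t -` A \<inter> space M | A. A \<in> sets (D i)})
    = (\<Union>(i, t)\<in>past k. {\<xi> i t -` A \<inter> space M | A. A \<in> sets (D i)})"
    by auto
  then show ?thesis by (simp add: history_def samples_def)
qed

lemma sample_measurable:
  assumes "i < n"
  shows "\<xi> i k \<in> measurable M (D i)"
proof -
  have "(i, k) \<in> {..<n} \<times> UNIV" using assms by simp
  with sample_indep show ?thesis unfolding indep_vars_def2 by fastforce
qed

lemma space_samples[simp]: "space (samples J) = space M"
  by (simp add: samples_def space_measure_of_conv)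

lemma sets_samples:
  "sets (samples J) = sigma_sets (space M) (\<Union>(i, t)\<in>J. {\<xi> i t -` A \<inter> space M | A. A \<in> sets (D i)})"
  unfolding samples_def by (rule sets_measure_of) auto

lemma samples_mono: "J \<subseteq> J' \<Longrightarrow> sets (samples J) \<subseteq> sets (samples J')"
  unfolding sets_samples by (intro sigma_sets_mono' UN_mono) auto

lemma measurable_samples_mono:
  assumes "Y \<in> measurable (samples J) T" "J \<subseteq> J'"
  shows "Y \<in> measurable (samples J') T"
  using assms(1) samples_mono[OF assms(2)] by (auto simp: measurable_def)

lemma sample_measurable_samples:
  assumes "i < n" "(i, t) \<in> J"
  shows "\<xi> i t \<in> measurable (samples J) (D i)"
proof (rule measurableI)
  fix \<omega> assume "\<omega> \<in> space (samples J)"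
  then show "\<xi> i t \<omega> \<in> space (D i)" using measurable_space[OF sample_measurable[OF assms(1)]] by simp
next
  fix A assume "A \<in> sets (D i)"
  then show "\<xi> i t -` A \<inter> space (samples J) \<in> sets (samples J)"
    unfolding sets_samples space_samples using assms(2) by (intro sigma_sets.Basic) blast
qed

lemma subalgebra_samples:
  assumes "J \<subseteq> {..<n} \<times> UNIV"
  shows "subalgebra M (samples J)"
  unfolding subalgebra_def sets_samples space_samples
proof (intro conjI refl sets.sigma_sets_subset subsetI)
  fix B assume "B \<in> (\<Union>(i, t)\<in>J. {\<xi> i t -` A \<inter> space M | A. A \<in> sets (D i)})"
  then show "B \<in> events" using assms sample_measurable by (auto intro: measurable_sets)
qed

lemma measurable_from_samples:
  assumes "Y \<in> measurable (samples J) T" "J \<subseteq> {..<n} \<times> UNIV"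
  shows "Y \<in> measurable M T"
  using measurable_from_subalg[OF subalgebra_samples[OF assms(2)] assms(1)] .

lemma sigma_finite_subalgebra_samples:
  assumes "J \<subseteq> {..<n} \<times> UNIV"
  shows "sigma_finite_subalgebra M (samples J)"
proof
  show "subalgebra M (samples J)" by (rule subalgebra_samples[OF assms])
  interpret R: prob_space "restr_to_subalg M (samples J)"
    by (rule prob_space_restr_to_subalg[OF subalgebra_samples[OF assms] prob_space_axioms])
  show "\<exists>A. countable A \<and> A \<subseteq> sets (restr_to_subalg M (samples J)) \<and>
      \<Union> A = space (restr_to_subalg M (samples J)) \<and>
      (\<forall>a\<in>A. emeasure (restr_to_subalg M (samples J)) a \<noteq> \<infinity>)"
    by (rule R.sigma_finite_countable)
qed

text \<open>The samples are grouped into the single \<open>(i, k)\<close> and the family \<open>J\<close>; the generators of the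
  two \<open>\<sigma>\<close>-algebras are intersection-stable for each sample, so independence passes from them to
  the generated \<open>\<sigma>\<close>-algebras.\<close>
lemma sample_indep_of_others:
  assumes i: "i < n" and new: "(i, k) \<notin> J" and J: "J \<subseteq> {..<n} \<times> UNIV"
    and A: "A \<in> sets (D i)" and B: "B \<in> sets (samples J)"
  shows "prob ((\<xi> i k -` A \<inter> space M) \<inter> B) = prob (\<xi> i k -` A \<inter> space M) * prob B"
proof -
  define E where "E = (\<lambda>(i, t). {\<xi> i t -` A \<inter> space M | A. A \<in> sets (D i)})"
  define I where "I = case_bool {(i, k)} J"
  have "indep_sets E ({..<n} \<times> UNIV)"
    using sample_indep unfolding indep_vars_def2 E_def by (simp add: case_prod_unfold)
  then have "indep_sets E (\<Union>b\<in>UNIV. I b)"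
    by (rule indep_sets_mono_index[rotated]) (use i J in \<open>auto simp: I_def split: bool.splits\<close>)
  moreover have "Int_stable (E p)" for p
  proof (rule Int_stableI)
    fix a b assume "a \<in> E p" "b \<in> E p"
    then obtain A B where "A \<in> sets (D (fst p))" "B \<in> sets (D (fst p))"
      "a = \<xi> (fst p) (snd p) -` A \<inter> space M" "b = \<xi> (fst p) (snd p) -` B \<inter> space M"
      by (auto simp: E_def case_prod_unfold)
    then show "a \<inter> b \<in> E p"
      by (auto simp: E_def case_prod_unfold intro!: exI[of _ "A \<inter> B"])
  qed
  moreover have "disjoint_family_on I UNIV"
    using new by (auto simp: disjoint_family_on_def I_def split: bool.splits)
  ultimately have ind: "indep_sets (\<lambda>b. sigma_sets (space M) (\<Union>p\<in>I b. E p)) UNIV"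
    by (intro indep_sets_collect_sigma)
  define C where "C = case_bool (\<xi> i k -` A \<inter> space M) B"
  have "prob (\<Inter>b\<in>UNIV. C b) = (\<Prod>b\<in>UNIV. prob (C b))"
  proof (rule indep_setsD[OF ind])
    have "C True \<in> sigma_sets (space M) (\<Union>p\<in>I True. E p)"
      using A by (auto simp: C_def I_def E_def intro!: sigma_sets.Basic)
    moreover have "C False \<in> sigma_sets (space M) (\<Union>p\<in>I False. E p)"
      using B by (simp add: C_def I_def E_def sets_samples)
    ultimately show "\<forall>b\<in>UNIV. C b \<in> sigma_sets (space M) (\<Union>p\<in>I b. E p)"
      by (metis (full_types))
  qed auto
  then show ?thesis by (simp add: UNIV_bool C_def Int_commute mult.commute)
qed

text \<open>The law of a fresh sample does not change when \<open>Y\<close>, a function of other samples, is held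
  fixed. Letting \<open>J\<close> be arbitrary covers both the past of step \<open>k\<close> and the past together with
  another worker's sample of the same step.\<close>
lemma freeze_sample:
  fixes \<phi> :: "'s \<Rightarrow> 'c \<Rightarrow> real"
  assumes i: "i < n" and new: "(i, k) \<notin> J" and J: "J \<subseteq> {..<n} \<times> UNIV"
    and \<phi>: "(\<lambda>(s, y). \<phi> s y) \<in> borel_measurable (D i \<Otimes>\<^sub>M T)"
    and Y: "Y \<in> measurable (samples J) T"
    and int: "integrable M (\<lambda>\<omega>. \<phi> (\<xi> i k \<omega>) (Y \<omega>))"
  shows "integrable M (\<lambda>\<omega>. \<integral>s. \<phi> s (Y \<omega>) \<partial>D i)"
    and "(\<integral>\<omega>. \<phi> (\<xi> i k \<omega>) (Y \<omega>) \<partial>M) = (\<integral>\<omega>. (\<integral>s. \<phi> s (Y \<omega>) \<partial>D i) \<partial>M)"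
proof -
  have indep: "prob ((\<xi> i k -` A \<inter> space M) \<inter> (Y -` B \<inter> space M))
      = prob (\<xi> i k -` A \<inter> space M) * prob (Y -` B \<inter> space M)"
    if "A \<in> sets (D i)" "B \<in> sets T" for A B
    using sample_indep_of_others[OF i new J that(1)] measurable_sets[OF Y that(2)] by simp
  note pair = integral_independent_pair[OF sample_measurable[OF i] measurable_from_samples[OF Y J] indep \<phi> int,
      unfolded sample_law[OF i]]
  show "integrable M (\<lambda>\<omega>. \<integral>s. \<phi> s (Y \<omega>) \<partial>D i)"
    and "(\<integral>\<omega>. \<phi> (\<xi> i k \<omega>) (Y \<omega>) \<partial>M) = (\<integral>\<omega>. (\<integral>s. \<phi> s (Y \<omega>) \<partial>D i) \<partial>M)"
    by (rule pair; assumption)+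
qed

lemma AE_sample:
  assumes "i < n" "AE s in D i. P s"
  shows "AE \<omega> in M. P (\<xi> i k \<omega>)"
proof (rule AE_distrD[OF sample_measurable[OF assms(1)]])
  show "AE s in distr M (D i) (\<xi> i k). P s" unfolding sample_law[OF assms(1)] by (rule assms(2))
qed

text \<open>The martingale difference property, tested against vectors \<open>Y\<close> instead of being stated by
  conditional expectations.\<close>
lemma integral_centered_sample_eq_0:
  fixes \<psi> :: "'s \<Rightarrow> 'a \<Rightarrow> 'a" and X Y :: "'o \<Rightarrow> 'a"
  assumes i: "i < n" and new: "(i, k) \<notin> J" and J: "J \<subseteq> {..<n} \<times> UNIV"
    and \<psi>: "(\<lambda>(s, y). \<psi> s y) \<in> borel_measurable (D i \<Otimes>\<^sub>M borel)"
    and int: "\<And>y. integrable (D i) (\<lambda>s. \<psi> s y)" and centered: "\<And>y. (\<integral>s. \<psi> s y \<partial>D i) = 0"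
    and X: "X \<in> borel_measurable (samples J)" and Y: "Y \<in> borel_measurable (samples J)"
    and sq: "sq_integrable M (\<lambda>\<omega>. \<psi> (\<xi> i k \<omega>) (X \<omega>))" "sq_integrable M Y"
  shows "(\<integral>\<omega>. \<psi> (\<xi> i k \<omega>) (X \<omega>) \<bullet> Y \<omega> \<partial>M) = 0"
proof -
  define \<phi> where "\<phi> s p = \<psi> s (fst p) \<bullet> snd p" for s p
  have "(\<lambda>p. (fst p, fst (snd p))) \<in> measurable
      (D i \<Otimes>\<^sub>M (borel :: 'a measure) \<Otimes>\<^sub>M (borel :: 'a measure)) (D i \<Otimes>\<^sub>M borel)"
    by measurable
  from measurable_compose[OF this \<psi>]
  have [measurable]: "(\<lambda>p. \<psi> (fst p) (fst (snd p))) \<in> borel_measurable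
      (D i \<Otimes>\<^sub>M (borel :: 'a measure) \<Otimes>\<^sub>M (borel :: 'a measure))"
    by simp
  have \<phi>: "(\<lambda>(s, p). \<phi> s p) \<in> borel_measurable
      (D i \<Otimes>\<^sub>M (borel :: 'a measure) \<Otimes>\<^sub>M (borel :: 'a measure))"
    unfolding case_prod_unfold \<phi>_def by measurable
  have XY: "(\<lambda>\<omega>. (X \<omega>, Y \<omega>)) \<in> measurable (samples J) (borel \<Otimes>\<^sub>M borel)"
    using X Y by (rule measurable_Pair)
  have "integrable M (\<lambda>\<omega>. \<phi> (\<xi> i k \<omega>) (X \<omega>, Y \<omega>))"
    using integrable_inner_sq[OF sq] by (simp add: \<phi>_def)
  from freeze_sample(2)[OF i new J \<phi> XY this]
  have "(\<integral>\<omega>. \<psi> (\<xi> i k \<omega>) (X \<omega>) \<bullet> Y \<omega> \<partial>M) = (\<integral>\<omega>. (\<integral>s. \<psi> s (X \<omega>) \<bullet> Y \<omega> \<partial>D i) \<partial>M)"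
    by (simp add: \<phi>_def)
  then show ?thesis using int centered by simp
qed

text \<open>Comparing each sampled gradient with its value at the minimizer splits \<open>g\<^sub>i\<^sup>k\<close> into a drift,
  of size at most \<open>L \<parallel>x\<^sup>k - x\<^sup>*\<parallel>\<close>, and a noise that does not depend on the iterate. The fluctuation
  is the drift minus its conditional mean.\<close>
definition drift :: "nat \<Rightarrow> nat \<Rightarrow> 'o \<Rightarrow> 'a" where
  "drift i k \<omega> = grad (F i (\<xi> i k \<omega>)) (x k \<omega>) - grad (F i (\<xi> i k \<omega>)) xs"

definition noise :: "nat \<Rightarrow> nat \<Rightarrow> 'o \<Rightarrow> 'a" where
  "noise i k \<omega> = grad (F i (\<xi> i k \<omega>)) xs - grad (loss i) xs"

definition fluct :: "nat \<Rightarrow> nat \<Rightarrow> 'o \<Rightarrow> 'a" where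
  "fluct i k \<omega> = drift i k \<omega> - (grad (loss i) (x k \<omega>) - grad (loss i) xs)"

lemma g_split: "i < n \<Longrightarrow> g i k \<omega> = drift i k \<omega> + noise i k \<omega>"
  by (simp add: g_eq drift_def noise_def)

lemma g_measurable_samples:
  assumes i: "i < n" and ik: "(i, k) \<in> J"
    and x: "x k \<in> borel_measurable (samples J)"
  shows "g i k \<in> borel_measurable (samples J)"
proof -
  have "(\<lambda>\<omega>. (\<xi> i k \<omega>, x k \<omega>)) \<in> measurable (samples J) (D i \<Otimes>\<^sub>M borel)"
    by (intro measurable_Pair sample_measurable_samples i ik x)
  from measurable_compose[OF this grad_measurable[OF i]]
  have "(\<lambda>\<omega>. grad (F i (\<xi> i k \<omega>)) (x k \<omega>)) \<in> borel_measurable (samples J)" by simp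
  then show ?thesis by (simp add: g_eq[OF i] cong: measurable_cong)
qed

text \<open>The induction is strong because the step to \<open>x (Suc j)\<close> uses the gradient at the delayed
  iterate \<open>x (j - \<tau>)\<close>.\<close>
lemma x_measurable: "x k \<in> borel_measurable (samples (past k))"
proof (induction k rule: less_induct)
  case (less k)
  show ?case
  proof (cases k)
    case 0
    have "x 0 = (\<lambda>\<omega>. x0)" using x_0 by (rule ext)
    then show ?thesis using 0 by simp
  next
    case (Suc j)
    have "v i j \<in> borel_measurable (samples (past k))" if i: "i < n" for i
    proof (cases "\<tau> \<le> j")
      case True
      have "g i (j - \<tau>) \<in> borel_measurable (samples (past k))"
        using less.IH[of "j - \<tau>"] Suc i
        by (intro g_measurable_samples i measurable_samples_mono[OF less.IH]) auto
      moreover have "v i j = (\<lambda>\<omega>. \<gamma> *\<^sub>R g i (j - \<tau>) \<omega>)" using v_eq[OF i] True by (simp add: fun_eq_iff)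
      ultimately show ?thesis by simp
    next
      case False
      then have "v i j = (\<lambda>\<omega>. 0)" using v_eq[OF i] by (simp add: fun_eq_iff)
      then show ?thesis by simp
    qed
    moreover have "x j \<in> borel_measurable (samples (past k))"
      using Suc by (intro measurable_samples_mono[OF less.IH]) auto
    moreover have "x k = (\<lambda>\<omega>. x j \<omega> - average n (\<lambda>i. v i j \<omega>))" using Suc x_Suc by (simp add: fun_eq_iff)
    ultimately show ?thesis by (simp add: average_def)
  qed
qed

lemma g_measurable: "i < n \<Longrightarrow> t < k \<Longrightarrow> g i t \<in> borel_measurable (samples (past k))"
  by (rule g_measurable_samples) (auto intro: measurable_samples_mono[OF x_measurable])

lemma past_subset: "past k \<subseteq> {..<n} \<times> UNIV" by auto

lemma x_borel[measurable]: "x k \<in> borel_measurable M"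
  by (rule measurable_from_samples[OF x_measurable past_subset])

lemma g_borel: "i < n \<Longrightarrow> g i k \<in> borel_measurable M"
  by (rule measurable_from_samples[OF g_measurable past_subset, of i k "Suc k"]) auto

lemma noise_measurable:
  assumes "i < n" "(i, k) \<in> J"
  shows "noise i k \<in> borel_measurable (samples J)"
proof -
  have "(\<lambda>\<omega>. grad (F i (\<xi> i k \<omega>)) xs) \<in> borel_measurable (samples J)"
    using measurable_compose[OF sample_measurable_samples[OF assms] sample_grad_measurable[OF assms(1)]] .
  then show ?thesis by (simp add: noise_def[abs_def])
qed

lemma noise_sq_integral:
  assumes "i < n"
  shows "sq_integrable M (noise i k)"
    and "(\<integral>\<omega>. (norm (noise i k \<omega>))\<^sup>2 \<partial>M) = grad_var D F i xs"
proof -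
  have N[measurable]: "noise i k \<in> borel_measurable M"
    by (rule measurable_from_samples[OF noise_measurable[OF assms, of k "{(i, k)}"]]) (use assms in auto)
  have m: "(\<lambda>s. (norm (grad (F i s) xs - grad (loss i) xs))\<^sup>2) \<in> borel_measurable (D i)"
    using sample_grad_measurable[OF assms] by measurable
  show "sq_integrable M (noise i k)"
    unfolding sq_integrable_def
    using N var_finite[OF assms] integrable_distr_eq[OF sample_measurable[OF assms, of k] m]
    by (simp add: noise_def sample_law[OF assms])
  show "(\<integral>\<omega>. (norm (noise i k \<omega>))\<^sup>2 \<partial>M) = grad_var D F i xs"
    using integral_distr[OF sample_measurable[OF assms, of k] m]
    by (simp add: noise_def grad_var_def sample_law[OF assms])
qed

lemma AE_drift_le:
  assumes "i < n"
  shows "AE \<omega> in M. norm (drift i k \<omega>) \<le> L * norm (x k \<omega> - xs)"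
  using AE_sample[OF assms sample_grad_lipschitz[OF assms], of k]
  by eventually_elim (simp add: drift_def)

lemma drift_eq: "i < n \<Longrightarrow> drift i k = (\<lambda>\<omega>. g i k \<omega> - noise i k \<omega>)"
  using g_split by (simp add: fun_eq_iff)

lemma noise_borel: "i < n \<Longrightarrow> noise i k \<in> borel_measurable M"
  using noise_sq_integral(1) by (rule sq_integrableD)

lemma drift_sq_integrable:
  assumes "i < n" "sq_integrable M (x k)"
  shows "sq_integrable M (drift i k)"
proof (rule sq_integrable_bound[OF _ _ AE_drift_le[OF assms(1)]])
  show "sq_integrable M (\<lambda>\<omega>. x k \<omega> - xs)"
    by (rule sq_integrable_diff[OF assms(2) sq_integrable_const])
  show "drift i k \<in> borel_measurable M"
    using g_borel[OF assms(1)] noise_borel[OF assms(1)] by (simp add: drift_eq[OF assms(1)])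
qed

lemma g_sq_integrable_of_x:
  assumes "i < n" "sq_integrable M (x k)"
  shows "sq_integrable M (g i k)"
proof -
  have "g i k = (\<lambda>\<omega>. drift i k \<omega> + noise i k \<omega>)" using g_split[OF assms(1)] by (simp add: fun_eq_iff)
  then show ?thesis
    using sq_integrable_add[OF drift_sq_integrable[OF assms] noise_sq_integral(1)[OF assms(1)]] by simp
qed

lemma x_sq_integrable: "sq_integrable M (x k)"
proof (induction k rule: less_induct)
  case (less k)
  show ?case
  proof (cases k)
    case 0
    have "x 0 = (\<lambda>\<omega>. x0)" using x_0 by (rule ext)
    then show ?thesis using 0 sq_integrable_const by simp
  next
    case (Suc j)
    have "sq_integrable M (v i j)" if i: "i < n" for i
    proof (cases "\<tau> \<le> j")
      case True
      have "sq_integrable M (g i (j - \<tau>))" using Suc by (intro g_sq_integrable_of_x i less.IH) simp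
      moreover have "v i j = (\<lambda>\<omega>. \<gamma> *\<^sub>R g i (j - \<tau>) \<omega>)" using v_eq[OF i] True by (simp add: fun_eq_iff)
      ultimately show ?thesis by (simp add: sq_integrable_scaleR)
    next
      case False
      then have "v i j = (\<lambda>\<omega>. 0)" using v_eq[OF i] by (simp add: fun_eq_iff)
      then show ?thesis by (simp add: sq_integrable_zero)
    qed
    then have "sq_integrable M (\<lambda>\<omega>. x j \<omega> - average n (\<lambda>i. v i j \<omega>))"
      using Suc by (intro sq_integrable_diff sq_integrable_average less.IH) auto
    moreover have "x k = (\<lambda>\<omega>. x j \<omega> - average n (\<lambda>i. v i j \<omega>))" using Suc x_Suc by (simp add: fun_eq_iff)
    ultimately show ?thesis by simp
  qed
qed

lemmas g_sq_integrable = g_sq_integrable_of_x[OF _ x_sq_integrable]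
lemmas drift_sq = drift_sq_integrable[OF _ x_sq_integrable]

lemma loss_grad_sq_integrable:
  assumes "i < n"
  shows "sq_integrable M (\<lambda>\<omega>. grad (loss i) (x k \<omega>) - grad (loss i) xs)"
proof (rule sq_integrable_bound[where c = L])
  show "sq_integrable M (\<lambda>\<omega>. x k \<omega> - xs)"
    by (rule sq_integrable_diff[OF x_sq_integrable sq_integrable_const])
  show "(\<lambda>\<omega>. grad (loss i) (x k \<omega>) - grad (loss i) xs) \<in> borel_measurable M"
    using loss_grad_borel[OF assms] by measurable
qed (use loss_grad_lipschitz[OF assms] in simp)

lemma fluct_sq_integrable: "i < n \<Longrightarrow> sq_integrable M (fluct i k)"
  unfolding fluct_def[abs_def] by (intro sq_integrable_diff drift_sq loss_grad_sq_integrable)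

lemma fluct_orthogonal:
  assumes i: "i < n" and Y: "Y \<in> borel_measurable (samples (past k))" "sq_integrable M Y"
  shows "(\<integral>\<omega>. fluct i k \<omega> \<bullet> Y \<omega> \<partial>M) = 0"
proof -
  define \<psi> where "\<psi> s y = grad (F i s) y - grad (F i s) xs - (grad (loss i) y - grad (loss i) xs)" for s y
  interpret D: prob_space "D i" by (rule prob_D[OF i])
  have eq: "fluct i k = (\<lambda>\<omega>. \<psi> (\<xi> i k \<omega>) (x k \<omega>))" by (simp add: fluct_def drift_def \<psi>_def fun_eq_iff)
  note [measurable] = loss_grad_borel[OF i] sample_grad_measurable[OF i] grad_measurable[OF i]
  have "(\<lambda>p. grad (F i (fst p)) (snd p)) \<in> borel_measurable (D i \<Otimes>\<^sub>M borel)"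
    using grad_measurable[OF i] by (simp add: case_prod_unfold)
  then have meas: "(\<lambda>(s, y). \<psi> s y) \<in> borel_measurable (D i \<Otimes>\<^sub>M borel)"
    unfolding \<psi>_def case_prod_unfold by measurable
  show ?thesis
    unfolding eq
  proof (rule integral_centered_sample_eq_0[OF i _ past_subset meas _ _ x_measurable Y(1) _ Y(2)])
    show "integrable (D i) (\<lambda>s. \<psi> s y)" "(\<integral>s. \<psi> s y \<partial>D i) = 0" for y
      using grad_integrable[OF i] by (simp_all add: \<psi>_def grad_unbiased[OF i] D.prob_space)
    show "sq_integrable M (\<lambda>\<omega>. \<psi> (\<xi> i k \<omega>) (x k \<omega>))"
      using fluct_sq_integrable[OF i, of k] by (simp add: eq)
  qed simp
qed

text \<open>Here \<open>J\<close> is arbitrary because the noises of two workers in the same step have to be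
  orthogonal, too.\<close>
lemma noise_orthogonal:
  assumes i: "i < n" and J: "(i, k) \<notin> J" "J \<subseteq> {..<n} \<times> UNIV"
    and Y: "Y \<in> borel_measurable (samples J)" "sq_integrable M Y"
  shows "(\<integral>\<omega>. noise i k \<omega> \<bullet> Y \<omega> \<partial>M) = 0"
proof -
  define \<psi> where "\<psi> s y = grad (F i s) xs - grad (loss i) xs" for s and y :: 'a
  interpret D: prob_space "D i" by (rule prob_D[OF i])
  have eq: "noise i k = (\<lambda>\<omega>. \<psi> (\<xi> i k \<omega>) 0)" by (simp add: noise_def \<psi>_def fun_eq_iff)
  note [measurable] = sample_grad_measurable[OF i]
  have meas: "(\<lambda>(s, y). \<psi> s y) \<in> borel_measurable (D i \<Otimes>\<^sub>M borel)"
    unfolding \<psi>_def case_prod_unfold by measurable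
  show ?thesis
    unfolding eq
  proof (rule integral_centered_sample_eq_0[OF i J meas _ _ _ Y(1) _ Y(2)])
    show "integrable (D i) (\<lambda>s. \<psi> s y)" "(\<integral>s. \<psi> s y \<partial>D i) = 0" for y
      using grad_integrable[OF i] by (simp_all add: \<psi>_def grad_unbiased[OF i] D.prob_space)
    show "sq_integrable M (\<lambda>\<omega>. \<psi> (\<xi> i k \<omega>) 0)"
      using noise_sq_integral(1)[OF i, of k] by (simp add: eq)
  qed simp
qed

end

section \<open>Second moments of the averaged stochastic gradient\<close>

text \<open>The common hypotheses of both parts of the theorem, which are the instances \<open>\<kappa> = 1\<close> and
  \<open>\<kappa> = L/\<mu>\<close>.\<close>
locale delayed_sgd_rate = delayed_sgd M n D F L \<xi> \<tau> \<gamma> x0 x g v e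
  for M :: "'o measure" and n :: nat and D :: "nat \<Rightarrow> 's measure"
    and F :: "nat \<Rightarrow> 's \<Rightarrow> 'a::euclidean_space \<Rightarrow> real" and L :: real
    and \<xi> :: "nat \<Rightarrow> nat \<Rightarrow> 'o \<Rightarrow> 's" and \<tau> :: nat and \<gamma> :: real and x0 :: 'a
    and x :: "nat \<Rightarrow> 'o \<Rightarrow> 'a" and g v e :: "nat \<Rightarrow> nat \<Rightarrow> 'o \<Rightarrow> 'a" +
  fixes \<mu> \<kappa> :: real
  assumes qsc: "quasi_strongly_convex \<mu> f"
    and mu_nonneg: "0 \<le> \<mu>"
    and kappa_pos: "0 < \<kappa>"
    and step_pos: "0 < \<gamma>"
    and step_le: "8 * \<kappa> * L * \<gamma> \<le> 1"
    and step_delay_le: "\<gamma> \<le> 1 / (8 * L * sqrt (2 * real \<tau> * (real \<tau> + 2 * \<kappa>)))"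
    and growth: "sample_grad_growth \<kappa>"
begin

lemma f_min: "f xs \<le> f y"
  by (rule quasi_strongly_convex_minimum[OF qsc])

lemma grad_min: "grad f xs = 0"
  by (rule grad_minimum_eq_0[OF objective_differentiable f_min])

lemma mu_le_L: "\<mu> \<le> L"
  by (rule quasi_strongly_convex_le_smooth[OF qsc objective_smooth])

lemma step_delay_sq: "128 * L\<^sup>2 * \<gamma>\<^sup>2 * real \<tau> * (real \<tau> + 2 * \<kappa>) \<le> 1"
proof -
  define S where "S = 2 * real \<tau> * (real \<tau> + 2 * \<kappa>)"
  have "S > 0" using delay_pos kappa_pos by (simp add: S_def)
  then have "\<gamma> * (8 * L * sqrt S) \<le> 1"
    using step_delay_le L_pos pos_le_divide_eq[of "8 * L * sqrt S" \<gamma> 1] unfolding S_def by simp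
  then have "(\<gamma> * (8 * L * sqrt S))\<^sup>2 \<le> 1"
    using step_pos L_pos \<open>S > 0\<close> by (intro power_le_one) auto
  then have "\<gamma>\<^sup>2 * (64 * L\<^sup>2 * S) \<le> 1" using \<open>S > 0\<close> by (simp add: power_mult_distrib)
  then show ?thesis by (simp add: S_def mult_ac)
qed

text \<open>The bound on \<open>\<gamma>\<^sup>2 \<tau> (\<tau> + 2\<kappa>)\<close> dominates one on \<open>\<gamma>\<^sup>2 \<tau>\<^sup>2\<close>.\<close>
lemma step_delay_linear: "8 * L * \<gamma> * real \<tau> \<le> 1"
proof -
  have "(8 * L * \<gamma> * real \<tau>)\<^sup>2 \<le> 128 * L\<^sup>2 * \<gamma>\<^sup>2 * real \<tau> * (real \<tau> + 2 * \<kappa>)"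
  proof -
    have "64 * (L\<^sup>2 * \<gamma>\<^sup>2 * (real \<tau>)\<^sup>2) \<le> 128 * (L\<^sup>2 * \<gamma>\<^sup>2 * (real \<tau>)\<^sup>2)" by simp
    moreover have "0 \<le> 256 * (L\<^sup>2 * \<gamma>\<^sup>2 * real \<tau> * \<kappa>)" using kappa_pos by simp
    ultimately show ?thesis by (simp add: power_mult_distrib power2_eq_square algebra_simps)
  qed
  also note step_delay_sq
  finally show ?thesis using power2_le_imp_le[of "8 * L * \<gamma> * real \<tau>" 1] by simp
qed

text \<open>With \<open>\<mu> \<le> L\<close>, the step size condition makes \<open>\<gamma>\<mu>/2\<close> so small that it is the minimum defining
  the rate.\<close>
lemma rate_bounds:
  shows rate_eq: "rate \<gamma> \<mu> 1 1 = \<gamma> * \<mu> / 2"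
    and rate_nonneg: "0 \<le> rate \<gamma> \<mu> 1 1"
    and rate_lt_1: "rate \<gamma> \<mu> 1 1 < 1"
    and rate_delay: "real \<tau> * rate \<gamma> \<mu> 1 1 \<le> 1 / 4"
proof -
  have "\<gamma> * \<mu> * real \<tau> \<le> \<gamma> * L * real \<tau>"
    using mu_le_L step_pos by (intro mult_right_mono mult_left_mono) auto
  then have *: "8 * (\<gamma> * \<mu> * real \<tau>) \<le> 1" using step_delay_linear by (simp add: mult_ac)
  have "\<gamma> * \<mu> * 1 \<le> \<gamma> * \<mu> * real \<tau>"
    using delay_pos step_pos mu_nonneg by (intro mult_left_mono) auto
  with * have "\<gamma> * \<mu> / 2 \<le> 1 / 4" by simp
  then show eq: "rate \<gamma> \<mu> 1 1 = \<gamma> * \<mu> / 2" by (simp add: rate_def)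
  show "0 \<le> rate \<gamma> \<mu> 1 1" unfolding eq using step_pos mu_nonneg by simp
  show "rate \<gamma> \<mu> 1 1 < 1" using eq \<open>\<gamma> * \<mu> / 2 \<le> 1 / 4\<close> by simp
  show "real \<tau> * rate \<gamma> \<mu> 1 1 \<le> 1 / 4" using * unfolding eq by (simp add: mult_ac)
qed

abbreviation gbar where "gbar k \<omega> \<equiv> average n (\<lambda>i. g i k \<omega>)"
abbreviation ebar where "ebar k \<omega> \<equiv> average n (\<lambda>i. e i k \<omega>)"
abbreviation driftbar where "driftbar k \<omega> \<equiv> average n (\<lambda>i. drift i k \<omega>)"
abbreviation noisebar where "noisebar k \<omega> \<equiv> average n (\<lambda>i. noise i k \<omega>)"
abbreviation fluctbar where "fluctbar k \<omega> \<equiv> average n (\<lambda>i. fluct i k \<omega>)"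
abbreviation gap where "gap k \<omega> \<equiv> f (x k \<omega>) - f xs"
abbreviation V where "V \<equiv> variance_at_min"

lemma driftbar_eq: "driftbar k \<omega> = grad f (x k \<omega>) + fluctbar k \<omega>"
proof -
  have "fluctbar k \<omega> = driftbar k \<omega> - (grad f (x k \<omega>) - grad f xs)"
    unfolding fluct_def grad_objective average_def by (simp add: sum_subtractf scaleR_diff_right)
  then show ?thesis by (simp add: grad_min)
qed

lemma gbar_eq: "gbar k \<omega> = driftbar k \<omega> + noisebar k \<omega>"
  by (simp add: average_def g_split sum.distrib scaleR_add_right)

lemma gbar_sq: "sq_integrable M (gbar k)"
  by (intro sq_integrable_average g_sq_integrable)
lemma driftbar_sq: "sq_integrable M (driftbar k)"
  by (intro sq_integrable_average drift_sq)
lemma noisebar_sq: "sq_integrable M (noisebar k)"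
  by (intro sq_integrable_average noise_sq_integral(1))
lemma fluctbar_sq: "sq_integrable M (fluctbar k)"
  by (intro sq_integrable_average fluct_sq_integrable)

lemma gbar_measurable: "t < k \<Longrightarrow> gbar t \<in> borel_measurable (samples (past k))"
  unfolding average_def
  by (intro borel_measurable_scaleR borel_measurable_sum borel_measurable_const g_measurable) auto

lemma noisebar_measurable: "t < k \<Longrightarrow> noisebar t \<in> borel_measurable (samples (past k))"
  unfolding average_def
  by (intro borel_measurable_scaleR borel_measurable_sum borel_measurable_const noise_measurable) auto

lemma x_measurable_later: "t \<le> k \<Longrightarrow> x t \<in> borel_measurable (samples (past k))"
  by (rule measurable_samples_mono[OF x_measurable]) auto

lemma grad_x_measurable: "t \<le> k \<Longrightarrow> (\<lambda>\<omega>. grad f (x t \<omega>)) \<in> borel_measurable (samples (past k))"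
  by (rule measurable_compose[OF x_measurable_later grad_objective_borel])

lemma fluctbar_measurable:
  assumes "t < k"
  shows "fluctbar t \<in> borel_measurable (samples (past k))"
proof -
  have "fluctbar t = (\<lambda>\<omega>. gbar t \<omega> - noisebar t \<omega> - grad f (x t \<omega>))"
    using driftbar_eq gbar_eq by (simp add: fun_eq_iff)
  then show ?thesis
    using gbar_measurable[OF assms] noisebar_measurable[OF assms] grad_x_measurable[of t k] assms by simp
qed

lemma grad_x_sq: "sq_integrable M (\<lambda>\<omega>. grad f (x k \<omega>))"
proof -
  have "(\<lambda>\<omega>. grad f (x k \<omega>)) = (\<lambda>\<omega>. driftbar k \<omega> - fluctbar k \<omega>)"
    by (simp add: driftbar_eq)
  then show ?thesis using sq_integrable_diff[OF driftbar_sq fluctbar_sq] by simp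
qed

lemma fluctbar_orthogonal:
  assumes "Y \<in> borel_measurable (samples (past k))" "sq_integrable M Y"
  shows "(\<integral>\<omega>. fluctbar k \<omega> \<bullet> Y \<omega> \<partial>M) = 0"
proof -
  have "(\<integral>\<omega>. fluctbar k \<omega> \<bullet> Y \<omega> \<partial>M) = (\<integral>\<omega>. (1 / real n) * (\<Sum>i<n. fluct i k \<omega> \<bullet> Y \<omega>) \<partial>M)"
    by (simp add: average_def inner_sum_left)
  also have "\<dots> = (1 / real n) * (\<Sum>i<n. \<integral>\<omega>. fluct i k \<omega> \<bullet> Y \<omega> \<partial>M)"
    using integrable_inner_sq[OF fluct_sq_integrable assms(2)]
    by (subst integral_mult_right_zero, subst Bochner_Integration.integral_sum) auto
  finally show ?thesis using fluct_orthogonal[OF _ assms] by simp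
qed

lemma noisebar_orthogonal:
  assumes "Y \<in> borel_measurable (samples (past k))" "sq_integrable M Y"
  shows "(\<integral>\<omega>. noisebar k \<omega> \<bullet> Y \<omega> \<partial>M) = 0"
proof -
  have "(\<integral>\<omega>. noisebar k \<omega> \<bullet> Y \<omega> \<partial>M) = (\<integral>\<omega>. (1 / real n) * (\<Sum>i<n. noise i k \<omega> \<bullet> Y \<omega>) \<partial>M)"
    by (simp add: average_def inner_sum_left)
  also have "\<dots> = (1 / real n) * (\<Sum>i<n. \<integral>\<omega>. noise i k \<omega> \<bullet> Y \<omega> \<partial>M)"
    using integrable_inner_sq[OF noise_sq_integral(1) assms(2)]
    by (subst integral_mult_right_zero, subst Bochner_Integration.integral_sum) auto
  finally show ?thesis using noise_orthogonal[OF _ _ past_subset assms] by simp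
qed

lemma gbar_inner_integral:
  assumes Y: "Y \<in> borel_measurable (samples (past k))" "sq_integrable M Y"
  shows "(\<integral>\<omega>. gbar k \<omega> \<bullet> Y \<omega> \<partial>M) = (\<integral>\<omega>. grad f (x k \<omega>) \<bullet> Y \<omega> \<partial>M)"
proof -
  have "(\<integral>\<omega>. gbar k \<omega> \<bullet> Y \<omega> \<partial>M)
      = (\<integral>\<omega>. grad f (x k \<omega>) \<bullet> Y \<omega> + fluctbar k \<omega> \<bullet> Y \<omega> + noisebar k \<omega> \<bullet> Y \<omega> \<partial>M)"
    by (simp add: gbar_eq driftbar_eq inner_add_left)
  then show ?thesis
    using integrable_inner_sq[OF fluctbar_sq Y(2)] integrable_inner_sq[OF noisebar_sq Y(2)]
      integrable_inner_sq[OF grad_x_sq Y(2)] fluctbar_orthogonal[OF Y] noisebar_orthogonal[OF Y]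
    by simp
qed

lemma samples_events: "A \<in> sets (samples (past k)) \<Longrightarrow> A \<in> events"
  using subalgebra_samples[OF past_subset] by (auto simp: subalgebra_def)

lemma gbar_cond_exp:
  "AE \<omega> in M. vec_cond_exp M (samples (past k)) (gbar k) \<omega> = grad f (x k \<omega>)"
proof -
  interpret S: sigma_finite_subalgebra M "samples (past k)"
    by (rule sigma_finite_subalgebra_samples[OF past_subset])
  have "AE \<omega> in M. real_cond_exp M (samples (past k)) (\<lambda>\<omega>. gbar k \<omega> \<bullet> b) \<omega> = grad f (x k \<omega>) \<bullet> b" for b
  proof (rule S.real_cond_exp_charact)
    show "integrable M (\<lambda>\<omega>. gbar k \<omega> \<bullet> b)" "integrable M (\<lambda>\<omega>. grad f (x k \<omega>) \<bullet> b)"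
      using integrable_inner_sq[OF _ sq_integrable_const] gbar_sq grad_x_sq by blast+
    show "(\<lambda>\<omega>. grad f (x k \<omega>) \<bullet> b) \<in> borel_measurable (samples (past k))"
      using grad_x_measurable[of k k] by simp
    fix A assume A: "A \<in> sets (samples (past k))"
    then have "(\<lambda>\<omega>. indicator A \<omega> *\<^sub>R b) \<in> borel_measurable (samples (past k))"
      by (intro borel_measurable_scaleR borel_measurable_indicator) auto
    from gbar_inner_integral[OF this sq_integrable_indicator[OF sq_integrable_const samples_events[OF A]]]
    show "(\<integral>\<omega>\<in>A. gbar k \<omega> \<bullet> b \<partial>M) = (\<integral>\<omega>\<in>A. grad f (x k \<omega>) \<bullet> b \<partial>M)"
      by (simp add: set_lebesgue_integral_def)
  qed
  then have "AE \<omega> in M. \<forall>b\<in>Basis. real_cond_exp M (samples (past k)) (\<lambda>\<omega>. gbar k \<omega> \<bullet> b) \<omega>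
      = grad f (x k \<omega>) \<bullet> b"
    by (intro AE_finite_allI) auto
  then show ?thesis
    by eventually_elim (simp add: vec_cond_exp_def euclidean_representation)
qed

lemma gap_integrable_of_sq:
  assumes "sq_integrable M X"
  shows "integrable M (\<lambda>\<omega>. f (X \<omega>) - f xs)"
proof (rule Bochner_Integration.integrable_bound)
  note [measurable] = sq_integrableD(1)[OF assms]
  show "integrable M (\<lambda>\<omega>. L / 2 * (norm (X \<omega> - xs))\<^sup>2)"
    using sq_integrableD(2)[OF sq_integrable_diff[OF assms sq_integrable_const]] by simp
  have "norm (f y - f xs) \<le> norm (L / 2 * (norm (y - xs))\<^sup>2)" for y
    using descent_lemma[OF objective_smooth, of y xs] f_min[of y] L_pos
    by (simp add: grad_min)
  then show "AE \<omega> in M. norm (f (X \<omega>) - f xs) \<le> norm (L / 2 * (norm (X \<omega> - xs))\<^sup>2)" by simp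
  show "(\<lambda>\<omega>. f (X \<omega>) - f xs) \<in> borel_measurable M" by measurable
qed

lemma gap_integrable: "integrable M (gap k)"
  by (rule gap_integrable_of_sq[OF x_sq_integrable])

lemma gap_nonneg: "0 \<le> gap k \<omega>" using f_min by simp

lemma indicator_mult_gap_integrable:
  "A \<in> events \<Longrightarrow> integrable M (\<lambda>\<omega>. indicator A \<omega> * gap k \<omega>)"
  using integrable_mult_indicator[OF _ gap_integrable] by simp

lemma indicator_norm_sq: 
  "indicator A \<omega> * (norm (u::'a))\<^sup>2 = (norm (indicator A \<omega> *\<^sub>R u))\<^sup>2"
  by (simp add: indicator_def)

text \<open>Restricted to an event of the past, the noises of the workers are still pairwise orthogonal,
  and each is independent of the event. Letting the event vary encodes a conditional expectation.\<close>
lemma noisebar_set_integral: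
  assumes A: "A \<in> sets (samples (past k))"
  shows "(\<integral>\<omega>. indicator A \<omega> * (norm (noisebar k \<omega>))\<^sup>2 \<partial>M) = prob A * (V / (real n)\<^sup>2)"
proof -
  have A': "A \<in> events" by (rule samples_events[OF A])
  let ?N = "\<lambda>i \<omega>. indicator A \<omega> *\<^sub>R noise i k \<omega>"
  have sq: "sq_integrable M (?N i)" if "i < n" for i
    by (intro sq_integrable_indicator noise_sq_integral(1) that A')
  have orth: "(\<integral>\<omega>. ?N i \<omega> \<bullet> ?N j \<omega> \<partial>M) = 0" if "i < n" "j < n" "i \<noteq> j" for i j
  proof -
    have "?N j \<in> borel_measurable (samples (insert (j, k) (past k)))"
      using that A samples_mono[of "past k" "insert (j, k) (past k)"]
      by (intro borel_measurable_scaleR borel_measurable_indicator noise_measurable) auto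
    then have "(\<integral>\<omega>. noise i k \<omega> \<bullet> ?N j \<omega> \<partial>M) = 0"
      using that by (intro noise_orthogonal[OF that(1) _ _ _ sq]) auto
    moreover have "(\<lambda>\<omega>. ?N i \<omega> \<bullet> ?N j \<omega>) = (\<lambda>\<omega>. noise i k \<omega> \<bullet> ?N j \<omega>)"
      by (simp add: indicator_def fun_eq_iff)
    ultimately show ?thesis by (simp only:)
  qed
  have each: "(\<integral>\<omega>. (norm (?N i \<omega>))\<^sup>2 \<partial>M) = prob A * grad_var D F i xs" if i: "i < n" for i
  proof -
    define \<phi> where "\<phi> s y = (norm (grad (F i s) xs - grad (loss i) xs))\<^sup>2 * y" for s and y :: real
    note [measurable] = sample_grad_measurable[OF i]
    have \<phi>: "(\<lambda>(s, y). \<phi> s y) \<in> borel_measurable (D i \<Otimes>\<^sub>M borel)"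
      unfolding \<phi>_def case_prod_unfold by measurable
    have "(\<integral>\<omega>. \<phi> (\<xi> i k \<omega>) (indicator A \<omega>) \<partial>M) = (\<integral>\<omega>. (\<integral>s. \<phi> s (indicator A \<omega>) \<partial>D i) \<partial>M)"
    proof (rule freeze_sample(2)[OF i _ past_subset \<phi>])
      show "(\<lambda>\<omega>. indicat_real A \<omega>) \<in> borel_measurable (samples (past k))" using A by simp
      show "integrable M (\<lambda>\<omega>. \<phi> (\<xi> i k \<omega>) (indicat_real A \<omega>))"
        using sq_integrableD(2)[OF sq[OF i]]
        unfolding indicator_norm_sq[symmetric] by (simp add: \<phi>_def noise_def mult.commute)
    qed simp
    then show ?thesis
      using A' unfolding indicator_norm_sq[symmetric]
      by (simp add: \<phi>_def noise_def grad_var_def mult.commute)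
  qed
  have "indicator A \<omega> * (norm (noisebar k \<omega>))\<^sup>2 = (norm (\<Sum>i<n. ?N i \<omega>))\<^sup>2 / (real n)\<^sup>2" for \<omega>
    by (simp add: average_def power_divide indicator_def)
  then have "(\<integral>\<omega>. indicator A \<omega> * (norm (noisebar k \<omega>))\<^sup>2 \<partial>M)
      = (\<integral>\<omega>. (norm (\<Sum>i<n. ?N i \<omega>))\<^sup>2 \<partial>M) / (real n)\<^sup>2"
    by simp
  also have "(\<integral>\<omega>. (norm (\<Sum>i<n. ?N i \<omega>))\<^sup>2 \<partial>M) = (\<Sum>i<n. \<integral>\<omega>. (norm (?N i \<omega>))\<^sup>2 \<partial>M)"
    using sq orth by (intro integral_norm_sq_sum_orthogonal) auto
  also have "\<dots> = prob A * V" using each by (simp add: variance_at_min_def sum_distrib_left)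
  finally show ?thesis by simp
qed

text \<open>For a frozen iterate, the average over the workers of the second moments is what
  \<open>sample_grad_growth\<close> bounds.\<close>
lemma driftbar_set_integral:
  assumes A: "A \<in> sets (samples (past k))"
  shows "(\<integral>\<omega>. indicator A \<omega> * (norm (driftbar k \<omega>))\<^sup>2 \<partial>M)
    \<le> 2 * \<kappa> * L * (\<integral>\<omega>. indicator A \<omega> * gap k \<omega> \<partial>M)"
proof -
  have A': "A \<in> events" by (rule samples_events[OF A])
  define \<Phi> where "\<Phi> i y = (\<integral>s. (norm (grad (F i s) y - grad (F i s) xs))\<^sup>2 \<partial>D i)" for i y
  have int: "integrable M (\<lambda>\<omega>. indicator A \<omega> * (norm (drift i k \<omega>))\<^sup>2)" if "i < n" for i
    using integrable_mult_indicator[OF A' sq_integrableD(2)[OF drift_sq[OF that]]] by simp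
  have each: "integrable M (\<lambda>\<omega>. indicator A \<omega> * \<Phi> i (x k \<omega>))"
    "(\<integral>\<omega>. indicator A \<omega> * (norm (drift i k \<omega>))\<^sup>2 \<partial>M) = (\<integral>\<omega>. indicator A \<omega> * \<Phi> i (x k \<omega>) \<partial>M)"
    if i: "i < n" for i
  proof -
    define \<phi> where "\<phi> s p = snd p * (norm (grad (F i s) (fst p) - grad (F i s) xs))\<^sup>2" for s and p :: "'a \<times> real"
    note [measurable] = sample_grad_measurable[OF i]
    have "(\<lambda>p. (fst p, fst (snd p))) \<in> measurable
        (D i \<Otimes>\<^sub>M (borel :: 'a measure) \<Otimes>\<^sub>M (borel :: real measure)) (D i \<Otimes>\<^sub>M borel)"
      by measurable
    from measurable_compose[OF this grad_measurable[OF i]]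
    have [measurable]: "(\<lambda>p. grad (F i (fst p)) (fst (snd p))) \<in> borel_measurable
        (D i \<Otimes>\<^sub>M (borel :: 'a measure) \<Otimes>\<^sub>M (borel :: real measure))"
      by simp
    have \<phi>: "(\<lambda>(s, p). \<phi> s p) \<in> borel_measurable
        (D i \<Otimes>\<^sub>M (borel :: 'a measure) \<Otimes>\<^sub>M (borel :: real measure))"
      unfolding \<phi>_def case_prod_unfold by measurable
    have Y: "(\<lambda>\<omega>. (x k \<omega>, indicat_real A \<omega>)) \<in> measurable (samples (past k)) (borel \<Otimes>\<^sub>M borel)"
      using A by (intro measurable_Pair x_measurable) auto
    have "integrable M (\<lambda>\<omega>. \<phi> (\<xi> i k \<omega>) (x k \<omega>, indicat_real A \<omega>))"
      using int[OF i] by (simp add: \<phi>_def drift_def)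
    note fr = freeze_sample[OF i _ past_subset \<phi> Y this]
    show "integrable M (\<lambda>\<omega>. indicator A \<omega> * \<Phi> i (x k \<omega>))"
      using fr(1) by (simp add: \<phi>_def \<Phi>_def)
    show "(\<integral>\<omega>. indicator A \<omega> * (norm (drift i k \<omega>))\<^sup>2 \<partial>M) = (\<integral>\<omega>. indicator A \<omega> * \<Phi> i (x k \<omega>) \<partial>M)"
      using fr(2) by (simp add: \<phi>_def \<Phi>_def drift_def)
  qed
  have "(\<integral>\<omega>. indicator A \<omega> * (norm (driftbar k \<omega>))\<^sup>2 \<partial>M)
      \<le> (\<integral>\<omega>. average n (\<lambda>i. indicator A \<omega> * (norm (drift i k \<omega>))\<^sup>2) \<partial>M)"
  proof (rule integral_mono)
    show "integrable M (\<lambda>\<omega>. indicator A \<omega> * (norm (driftbar k \<omega>))\<^sup>2)"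
      using integrable_mult_indicator[OF A' sq_integrableD(2)[OF driftbar_sq]] by simp
    show "integrable M (\<lambda>\<omega>. average n (\<lambda>i. indicator A \<omega> * (norm (drift i k \<omega>))\<^sup>2))"
      by (intro integrable_average int)
    show "indicator A \<omega> * (norm (driftbar k \<omega>))\<^sup>2 \<le> average n (\<lambda>i. indicator A \<omega> * (norm (drift i k \<omega>))\<^sup>2)"
      for \<omega> using norm_average_sq_le[of n "\<lambda>i. drift i k \<omega>"] by (simp add: indicator_def average_def)
  qed
  also have "\<dots> = average n (\<lambda>i. \<integral>\<omega>. indicator A \<omega> * (norm (drift i k \<omega>))\<^sup>2 \<partial>M)"
    using int by (rule integral_average)
  also have "\<dots> = average n (\<lambda>i. \<integral>\<omega>. indicator A \<omega> * \<Phi> i (x k \<omega>) \<partial>M)"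
    using each(2) by (simp add: average_def)
  also have "\<dots> = (\<integral>\<omega>. average n (\<lambda>i. indicator A \<omega> * \<Phi> i (x k \<omega>)) \<partial>M)"
    using each(1) by (rule integral_average[symmetric])
  also have "\<dots> \<le> (\<integral>\<omega>. 2 * \<kappa> * L * (indicator A \<omega> * gap k \<omega>) \<partial>M)"
  proof (rule integral_mono)
    show "integrable M (\<lambda>\<omega>. average n (\<lambda>i. indicator A \<omega> * \<Phi> i (x k \<omega>)))"
      by (intro integrable_average each(1))
    show "integrable M (\<lambda>\<omega>. 2 * \<kappa> * L * (indicator A \<omega> * gap k \<omega>))"
      using indicator_mult_gap_integrable[OF A'] by (intro integrable_mult_right)
    show "average n (\<lambda>i. indicator A \<omega> * \<Phi> i (x k \<omega>)) \<le> 2 * \<kappa> * L * (indicator A \<omega> * gap k \<omega>)" for \<omega>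
      using growth by (simp add: sample_grad_growth_def \<Phi>_def indicator_def average_def)
  qed
  finally show ?thesis by simp
qed

lemma gbar_second_moment_set:
  assumes A: "A \<in> sets (samples (past k))"
  shows "(\<integral>\<omega>. indicator A \<omega> * (norm (gbar k \<omega>))\<^sup>2 \<partial>M)
    \<le> (\<integral>\<omega>. indicator A \<omega> * (4 * \<kappa> * L * gap k \<omega> + 2 / (real n)\<^sup>2 * V) \<partial>M)"
proof -
  have A': "A \<in> events" by (rule samples_events[OF A])
  have iA: "integrable M (\<lambda>\<omega>. indicator A \<omega> * (norm (Z \<omega>))\<^sup>2)" if "sq_integrable M Z" for Z :: "'o \<Rightarrow> 'a"
    using integrable_mult_indicator[OF A' sq_integrableD(2)[OF that]] by simp
  have "(\<integral>\<omega>. indicator A \<omega> * (norm (gbar k \<omega>))\<^sup>2 \<partial>M)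
    \<le> (\<integral>\<omega>. 2 * (indicator A \<omega> * (norm (driftbar k \<omega>))\<^sup>2) + 2 * (indicator A \<omega> * (norm (noisebar k \<omega>))\<^sup>2) \<partial>M)"
    using iA[OF gbar_sq] iA[OF driftbar_sq] iA[OF noisebar_sq] norm_add_sq_le
    by (intro integral_mono) (auto simp: gbar_eq indicator_def)
  also have "\<dots> = 2 * (\<integral>\<omega>. indicator A \<omega> * (norm (driftbar k \<omega>))\<^sup>2 \<partial>M) + 2 * (prob A * (V / (real n)\<^sup>2))"
    using iA[OF driftbar_sq] iA[OF noisebar_sq] noisebar_set_integral[OF A] by simp
  also have "\<dots> \<le> 4 * \<kappa> * L * (\<integral>\<omega>. indicator A \<omega> * gap k \<omega> \<partial>M) + prob A * (2 / (real n)\<^sup>2 * V)"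
    using driftbar_set_integral[OF A] by (simp add: mult_ac)
  also have "\<dots> = (\<integral>\<omega>. 4 * \<kappa> * L * (indicator A \<omega> * gap k \<omega>) + indicator A \<omega> * (2 / (real n)\<^sup>2 * V) \<partial>M)"
  proof -
    have "integrable M (\<lambda>\<omega>. indicator A \<omega> * (2 / (real n)\<^sup>2 * V))"
      using A' by (intro integrable_mult_left integrable_real_indicator) (auto simp: emeasure_eq_measure)
    moreover have "(\<integral>\<omega>. indicator A \<omega> * (2 / (real n)\<^sup>2 * V) \<partial>M) = prob A * (2 / (real n)\<^sup>2 * V)"
      using A' by (subst integral_mult_left_zero) simp
    ultimately show ?thesis
      using indicator_mult_gap_integrable[OF A', of k] by (simp only: Bochner_Integration.integral_add
          integrable_mult_right integral_mult_right_zero)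
  qed
  finally show ?thesis by (simp add: algebra_simps)
qed

lemma gbar_second_moment_cond:
  "AE \<omega> in M. real_cond_exp M (samples (past k)) (\<lambda>\<omega>. (norm (gbar k \<omega>))\<^sup>2) \<omega>
    \<le> 4 * \<kappa> * L * gap k \<omega> + 2 / (real n)\<^sup>2 * V"
proof -
  interpret S: sigma_finite_subalgebra M "samples (past k)"
    by (rule sigma_finite_subalgebra_samples[OF past_subset])
  show ?thesis
  proof (rule S.real_cond_exp_le)
    show "integrable M (\<lambda>\<omega>. (norm (gbar k \<omega>))\<^sup>2)" by (rule sq_integrableD(2)[OF gbar_sq])
    show "integrable M (\<lambda>\<omega>. 4 * \<kappa> * L * gap k \<omega> + 2 / (real n)\<^sup>2 * V)"
      using gap_integrable by (intro Bochner_Integration.integrable_add integrable_mult_right integrable_const)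
    show "(\<lambda>\<omega>. 4 * \<kappa> * L * gap k \<omega> + 2 / (real n)\<^sup>2 * V) \<in> borel_measurable (samples (past k))"
      using measurable_compose[OF x_measurable objective_borel, of k] by measurable
  qed (use gbar_second_moment_set in \<open>simp add: set_lebesgue_integral_def\<close>)
qed

lemma gbar_second_moment:
  "(\<integral>\<omega>. (norm (gbar k \<omega>))\<^sup>2 \<partial>M) \<le> 4 * \<kappa> * L * (\<integral>\<omega>. gap k \<omega> \<partial>M) + 2 / (real n)\<^sup>2 * V"
proof -
  have "space M \<in> sets (samples (past k))" using sets.top[of "samples (past k)"] by simp
  from gbar_second_moment_set[OF this]
  have "(\<integral>\<omega>. (norm (gbar k \<omega>))\<^sup>2 \<partial>M) \<le> (\<integral>\<omega>. 4 * \<kappa> * L * gap k \<omega> + 2 / (real n)\<^sup>2 * V \<partial>M)"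
    by (simp cong: Bochner_Integration.integral_cong)
  also have "\<dots> = 4 * \<kappa> * L * (\<integral>\<omega>. gap k \<omega> \<partial>M) + 2 / (real n)\<^sup>2 * V"
    using gap_integrable[of k] by (subst Bochner_Integration.integral_add) (simp_all only: integrable_mult_right
        integrable_const integral_mult_right_zero lebesgue_integral_const prob_space scaleR_one)
  finally show ?thesis .
qed

end

section \<open>The error sequence and the virtual iterates\<close>

context delayed_sgd_rate
begin

text \<open>The recursion adds the newest term and removes the one of \<open>\<tau>\<close> steps ago. Truncated
  subtraction lets the window start at 0 during the first \<open>\<tau>\<close> steps, when nothing is removed.\<close>
lemma ebar_eq: "ebar k \<omega> = \<gamma> *\<^sub>R (\<Sum>t\<in>{k - \<tau>..<k}. gbar t \<omega>)"
proof (induction k)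
  case 0
  then show ?case by (simp add: average_def e_0)
next
  case (Suc k)
  have "ebar (Suc k) \<omega> = ebar k \<omega> + \<gamma> *\<^sub>R gbar k \<omega> - average n (\<lambda>i. v i k \<omega>)"
    by (simp add: average_def e_Suc sum.distrib sum_subtractf scaleR_add_right scaleR_diff_right
        scaleR_sum_right mult.commute)
  also have "average n (\<lambda>i. v i k \<omega>) = (if \<tau> \<le> k then \<gamma> *\<^sub>R gbar (k - \<tau>) \<omega> else 0)"
    by (simp add: average_def v_eq scaleR_sum_right mult.commute)
  also have "ebar k \<omega> + \<gamma> *\<^sub>R gbar k \<omega> - (if \<tau> \<le> k then \<gamma> *\<^sub>R gbar (k - \<tau>) \<omega> else 0)
      = \<gamma> *\<^sub>R (\<Sum>t\<in>{Suc k - \<tau>..<Suc k}. gbar t \<omega>)"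
  proof (cases "\<tau> \<le> k")
    case True
    then have "(\<Sum>t\<in>{k - \<tau>..<k}. gbar t \<omega>) = gbar (k - \<tau>) \<omega> + (\<Sum>t\<in>{Suc k - \<tau>..<k}. gbar t \<omega>)"
      using delay_pos by (simp add: sum.atLeast_Suc_lessThan[of "k - \<tau>" k] Suc_diff_le)
    moreover have "(\<Sum>t\<in>{Suc k - \<tau>..<Suc k}. gbar t \<omega>) = (\<Sum>t\<in>{Suc k - \<tau>..<k}. gbar t \<omega>) + gbar k \<omega>"
      using delay_pos by (subst sum.atLeastLessThan_Suc) auto
    ultimately show ?thesis using True by (simp only: Suc.IH) (simp add: scaleR_add_right)
  next
    case False
    then show ?thesis by (simp only: Suc.IH) (simp add: scaleR_add_right not_le)
  qed
  finally show ?case .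
qed

lemma ebar_sq: "sq_integrable M (ebar k)"
  unfolding ebar_eq by (intro sq_integrable_scaleR sq_integrable_sum gbar_sq)

lemma ebar_measurable: "ebar k \<in> borel_measurable (samples (past k))"
  unfolding ebar_eq
  by (intro borel_measurable_scaleR borel_measurable_sum borel_measurable_const gbar_measurable) auto

lemma grad_norm_sq_le: "(norm (grad f y))\<^sup>2 \<le> 2 * L * (f y - f xs)"
  by (rule grad_norm_sq_le_gap[OF objective_smooth L_pos f_min])

lemma integral_space:
  fixes h :: "'o \<Rightarrow> real"
  shows "(\<integral>\<omega>. indicator (space M) \<omega> * h \<omega> \<partial>M) = (\<integral>\<omega>. h \<omega> \<partial>M)"
  by (simp cong: Bochner_Integration.integral_cong)

lemma space_in_samples: "space M \<in> sets (samples J)"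
  using sets.top[of "samples J"] by simp

lemma driftbar_second_moment:
  "(\<integral>\<omega>. (norm (driftbar k \<omega>))\<^sup>2 \<partial>M) \<le> 2 * \<kappa> * L * (\<integral>\<omega>. gap k \<omega> \<partial>M)"
  using driftbar_set_integral[OF space_in_samples] unfolding integral_space .

lemma noisebar_second_moment: "(\<integral>\<omega>. (norm (noisebar k \<omega>))\<^sup>2 \<partial>M) = V / (real n)\<^sup>2"
  using noisebar_set_integral[OF space_in_samples, of k] unfolding integral_space by (simp add: prob_space)

text \<open>By orthogonality, the second moment of the drift is that of the fluctuation plus that of
  \<open>\<nabla>f(x\<^sup>k)\<close>.\<close>
lemma fluctbar_second_moment:
  "(\<integral>\<omega>. (norm (fluctbar k \<omega>))\<^sup>2 \<partial>M) \<le> 2 * \<kappa> * L * (\<integral>\<omega>. gap k \<omega> \<partial>M)"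
proof -
  have "(norm (driftbar k \<omega>))\<^sup>2 = (norm (fluctbar k \<omega>))\<^sup>2
      + 2 * (fluctbar k \<omega> \<bullet> grad f (x k \<omega>)) + (norm (grad f (x k \<omega>)))\<^sup>2" for \<omega>
    unfolding driftbar_eq power2_norm_eq_inner by (simp add: inner_simps inner_commute)
  then have "(\<integral>\<omega>. (norm (driftbar k \<omega>))\<^sup>2 \<partial>M) = (\<integral>\<omega>. (norm (fluctbar k \<omega>))\<^sup>2 \<partial>M)
      + (\<integral>\<omega>. (norm (grad f (x k \<omega>)))\<^sup>2 \<partial>M)"
    using sq_integrableD(2)[OF fluctbar_sq] sq_integrableD(2)[OF grad_x_sq]
      integrable_inner_sq[OF fluctbar_sq grad_x_sq]
      fluctbar_orthogonal[OF grad_x_measurable[OF order_refl] grad_x_sq]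
    by simp
  moreover have "0 \<le> (\<integral>\<omega>. (norm (grad f (x k \<omega>)))\<^sup>2 \<partial>M)" by simp
  ultimately show ?thesis using driftbar_second_moment[of k] by linarith
qed

lemma second_moment_sum_orthogonal:
  fixes Z :: "nat \<Rightarrow> 'o \<Rightarrow> 'a"
  assumes sq: "\<And>t. sq_integrable M (Z t)"
    and meas: "\<And>s t. s < t \<Longrightarrow> Z s \<in> borel_measurable (samples (past t))"
    and orth: "\<And>t Y. Y \<in> borel_measurable (samples (past t)) \<Longrightarrow> sq_integrable M Y \<Longrightarrow>
      (\<integral>\<omega>. Z t \<omega> \<bullet> Y \<omega> \<partial>M) = 0"
    and "finite I"
  shows "(\<integral>\<omega>. (norm (\<Sum>t\<in>I. Z t \<omega>))\<^sup>2 \<partial>M) = (\<Sum>t\<in>I. \<integral>\<omega>. (norm (Z t \<omega>))\<^sup>2 \<partial>M)"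
proof (rule integral_norm_sq_sum_orthogonal[OF \<open>finite I\<close> sq])
  fix s t :: nat assume "s \<noteq> t"
  then consider "s < t" | "t < s" by linarith
  then show "(\<integral>\<omega>. Z s \<omega> \<bullet> Z t \<omega> \<partial>M) = 0"
  proof cases
    case 1
    then show ?thesis using orth[OF meas[OF 1] sq] by (simp add: inner_commute)
  next
    case 2
    then show ?thesis using orth[OF meas[OF 2] sq] by simp
  qed
qed

text \<open>Two applications of \<open>\<parallel>a + b\<parallel>\<^sup>2 \<le> 2\<parallel>a\<parallel>\<^sup>2 + 2\<parallel>b\<parallel>\<^sup>2\<close> separate first the noise and then the
  fluctuations from the full gradients. Separating the noise first leaves it with the factor 2,
  which the constant \<open>D\<^sub>3\<close> requires. Only the full gradients are estimated by Cauchy--Schwarz;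
  orthogonality handles the other two sums.\<close>
lemma ebar_second_moment:
  "(\<integral>\<omega>. (norm (ebar k \<omega>))\<^sup>2 \<partial>M) \<le> \<gamma>\<^sup>2 * (8 * L * (real \<tau> + \<kappa>) * (\<Sum>t\<in>{k - \<tau>..<k}. \<integral>\<omega>. gap t \<omega> \<partial>M)
    + 2 * real \<tau> * (V / (real n)\<^sup>2))"
proof -
  define I where "I = {k - \<tau>..<k}"
  have card: "real (card I) \<le> real \<tau>" by (simp add: I_def)
  let ?G = "\<lambda>\<omega>. \<Sum>t\<in>I. grad f (x t \<omega>)" and ?M = "\<lambda>\<omega>. \<Sum>t\<in>I. fluctbar t \<omega>"
    and ?N = "\<lambda>\<omega>. \<Sum>t\<in>I. noisebar t \<omega>"
  have sq: "sq_integrable M ?G" "sq_integrable M ?M" "sq_integrable M ?N"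
    by (intro sq_integrable_sum grad_x_sq fluctbar_sq noisebar_sq)+
  have split: "(norm (ebar k \<omega>))\<^sup>2 \<le> \<gamma>\<^sup>2 * (4 * (norm (?G \<omega>))\<^sup>2 + 4 * (norm (?M \<omega>))\<^sup>2 + 2 * (norm (?N \<omega>))\<^sup>2)"
    for \<omega>
  proof -
    have "ebar k \<omega> = \<gamma> *\<^sub>R (?G \<omega> + ?M \<omega> + ?N \<omega>)"
      unfolding ebar_eq by (simp add: I_def gbar_eq driftbar_eq sum.distrib)
    then have "(norm (ebar k \<omega>))\<^sup>2 = \<gamma>\<^sup>2 * (norm (?G \<omega> + ?M \<omega> + ?N \<omega>))\<^sup>2"
      by (simp add: power_mult_distrib)
    also have "\<dots> \<le> \<gamma>\<^sup>2 * (4 * (norm (?G \<omega>))\<^sup>2 + 4 * (norm (?M \<omega>))\<^sup>2 + 2 * (norm (?N \<omega>))\<^sup>2)"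
      using norm_add_sq_le[of "?G \<omega> + ?M \<omega>" "?N \<omega>"] norm_add_sq_le[of "?G \<omega>" "?M \<omega>"]
      by (intro mult_left_mono) auto
    finally show ?thesis .
  qed
  have "(\<integral>\<omega>. (norm (ebar k \<omega>))\<^sup>2 \<partial>M)
      \<le> (\<integral>\<omega>. \<gamma>\<^sup>2 * (4 * (norm (?G \<omega>))\<^sup>2 + 4 * (norm (?M \<omega>))\<^sup>2 + 2 * (norm (?N \<omega>))\<^sup>2) \<partial>M)"
    using sq_integrableD(2)[OF ebar_sq] sq_integrableD(2)[OF sq(1)] sq_integrableD(2)[OF sq(2)]
      sq_integrableD(2)[OF sq(3)] split
    by (intro integral_mono) auto
  also have "\<dots> = \<gamma>\<^sup>2 * (4 * (\<integral>\<omega>. (norm (?G \<omega>))\<^sup>2 \<partial>M) + 4 * (\<integral>\<omega>. (norm (?M \<omega>))\<^sup>2 \<partial>M)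
      + 2 * (\<integral>\<omega>. (norm (?N \<omega>))\<^sup>2 \<partial>M))"
    using sq_integrableD(2)[OF sq(1)] sq_integrableD(2)[OF sq(2)] sq_integrableD(2)[OF sq(3)]
    by simp
  also have "\<dots> \<le> \<gamma>\<^sup>2 * (4 * (real \<tau> * (2 * L * (\<Sum>t\<in>I. \<integral>\<omega>. gap t \<omega> \<partial>M)))
      + 4 * (2 * \<kappa> * L * (\<Sum>t\<in>I. \<integral>\<omega>. gap t \<omega> \<partial>M)) + 2 * (real \<tau> * (V / (real n)\<^sup>2)))"
  proof (intro mult_left_mono add_mono)
    have "(\<integral>\<omega>. (norm (?G \<omega>))\<^sup>2 \<partial>M) \<le> (\<integral>\<omega>. real \<tau> * (2 * L * (\<Sum>t\<in>I. gap t \<omega>)) \<partial>M)"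
    proof (rule integral_mono)
      show "integrable M (\<lambda>\<omega>. (norm (?G \<omega>))\<^sup>2)" by (rule sq_integrableD(2)[OF sq(1)])
      show "integrable M (\<lambda>\<omega>. real \<tau> * (2 * L * (\<Sum>t\<in>I. gap t \<omega>)))"
        by (intro integrable_mult_right Bochner_Integration.integrable_sum gap_integrable)
      fix \<omega>
      have "(norm (?G \<omega>))\<^sup>2 \<le> real (card I) * (\<Sum>t\<in>I. (norm (grad f (x t \<omega>)))\<^sup>2)"
        by (rule norm_sum_sq_le)
      also have "\<dots> \<le> real \<tau> * (\<Sum>t\<in>I. 2 * L * gap t \<omega>)"
        using card grad_norm_sq_le by (intro mult_mono sum_mono sum_nonneg) auto
      finally show "(norm (?G \<omega>))\<^sup>2 \<le> real \<tau> * (2 * L * (\<Sum>t\<in>I. gap t \<omega>))"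
        by (simp only: sum_distrib_left)
    qed
    also have "\<dots> = real \<tau> * (2 * L * (\<Sum>t\<in>I. \<integral>\<omega>. gap t \<omega> \<partial>M))"
      unfolding integral_mult_right_zero
      by (subst Bochner_Integration.integral_sum) (use gap_integrable in auto)
    finally show "(\<integral>\<omega>. (norm (?G \<omega>))\<^sup>2 \<partial>M) \<le> real \<tau> * (2 * L * (\<Sum>t\<in>I. \<integral>\<omega>. gap t \<omega> \<partial>M))" .
    have "(\<integral>\<omega>. (norm (?M \<omega>))\<^sup>2 \<partial>M) = (\<Sum>t\<in>I. \<integral>\<omega>. (norm (fluctbar t \<omega>))\<^sup>2 \<partial>M)"
      by (rule second_moment_sum_orthogonal[OF fluctbar_sq fluctbar_measurable fluctbar_orthogonal])
         (simp_all add: I_def)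
    also have "\<dots> \<le> (\<Sum>t\<in>I. 2 * \<kappa> * L * (\<integral>\<omega>. gap t \<omega> \<partial>M))"
      by (intro sum_mono fluctbar_second_moment)
    finally show "(\<integral>\<omega>. (norm (?M \<omega>))\<^sup>2 \<partial>M) \<le> 2 * \<kappa> * L * (\<Sum>t\<in>I. \<integral>\<omega>. gap t \<omega> \<partial>M)"
      by (simp only: sum_distrib_left)
    have "(\<integral>\<omega>. (norm (?N \<omega>))\<^sup>2 \<partial>M) = (\<Sum>t\<in>I. \<integral>\<omega>. (norm (noisebar t \<omega>))\<^sup>2 \<partial>M)"
      by (rule second_moment_sum_orthogonal[OF noisebar_sq noisebar_measurable noisebar_orthogonal])
         (simp_all add: I_def)
    also have "\<dots> = real (card I) * (V / (real n)\<^sup>2)" by (simp add: noisebar_second_moment)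
    also have "\<dots> \<le> real \<tau> * (V / (real n)\<^sup>2)"
      using card variance_at_min_nonneg by (intro mult_right_mono) auto
    finally show "(\<integral>\<omega>. (norm (?N \<omega>))\<^sup>2 \<partial>M) \<le> real \<tau> * (V / (real n)\<^sup>2)" .
  qed auto
  finally show ?thesis unfolding I_def[symmetric] by (simp add: algebra_simps)
qed

abbreviation \<eta> where "\<eta> \<equiv> rate \<gamma> \<mu> 1 1"

text \<open>The gap terms come with the factor \<open>3L \<cdot> 8L\<gamma>\<^sup>2(\<tau> + \<kappa>) \<cdot> 4\<tau>/3 = 32 L\<^sup>2\<gamma>\<^sup>2\<tau>(\<tau> + \<kappa>)\<close>, which is at
  most \<open>1/4\<close> by the choice of the step size.\<close>
lemma weighted_error_bound:
  "3 * L * (\<Sum>k\<le>K. weight \<eta> k * (\<integral>\<omega>. (norm (ebar k \<omega>))\<^sup>2 \<partial>M))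
    \<le> 1 / 4 * (\<Sum>k\<le>K. weight \<eta> k * (\<integral>\<omega>. gap k \<omega> \<partial>M))
      + \<gamma> * (6 * \<gamma> * real \<tau> * L / (real n)\<^sup>2 * V) * total_weight \<eta> K"
proof -
  define d where "d t = (\<integral>\<omega>. gap t \<omega> \<partial>M)" for t
  define S where "S = (\<Sum>k\<le>K. weight \<eta> k * d k)"
  define c where "c = \<gamma>\<^sup>2 * (8 * L * (real \<tau> + \<kappa>))"
  define b where "b = \<gamma>\<^sup>2 * (2 * real \<tau> * (V / (real n)\<^sup>2))"
  have d: "0 \<le> d t" for t unfolding d_def by (intro Bochner_Integration.integral_nonneg gap_nonneg)
  have w: "0 \<le> weight \<eta> k" for k using weight_pos[OF rate_lt_1] by (simp add: less_imp_le)
  have S: "0 \<le> S" unfolding S_def by (intro sum_nonneg mult_nonneg_nonneg w d)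
  have c: "0 \<le> c" using L_pos kappa_pos by (simp add: c_def)
  have "(\<Sum>k\<le>K. weight \<eta> k * (\<integral>\<omega>. (norm (ebar k \<omega>))\<^sup>2 \<partial>M))
      \<le> (\<Sum>k\<le>K. weight \<eta> k * (c * (\<Sum>t\<in>{k - \<tau>..<k}. d t) + b))"
    using ebar_second_moment w
    by (intro sum_mono mult_left_mono) (auto simp: c_def b_def d_def algebra_simps)
  also have "\<dots> = c * (\<Sum>k\<le>K. weight \<eta> k * (\<Sum>t\<in>{k - \<tau>..<k}. d t)) + b * total_weight \<eta> K"
    by (simp add: distrib_left sum.distrib total_weight_def sum_distrib_left sum_distrib_right mult_ac)
  also have "\<dots> \<le> c * (4 / 3 * real \<tau> * S) + b * total_weight \<eta> K"
    unfolding S_def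
    by (intro add_right_mono mult_left_mono weighted_window_sum_le rate_nonneg rate_lt_1 rate_delay d c)
  finally have "3 * L * (\<Sum>k\<le>K. weight \<eta> k * (\<integral>\<omega>. (norm (ebar k \<omega>))\<^sup>2 \<partial>M))
      \<le> 3 * L * (c * (4 / 3 * real \<tau> * S) + b * total_weight \<eta> K)"
    using L_pos by (intro mult_left_mono) auto
  also have "\<dots> = (32 * L\<^sup>2 * \<gamma>\<^sup>2 * real \<tau> * (real \<tau> + \<kappa>)) * S
      + \<gamma> * (6 * \<gamma> * real \<tau> * L / (real n)\<^sup>2 * V) * total_weight \<eta> K"
    by (simp add: c_def b_def power2_eq_square algebra_simps)
  also have "(32 * L\<^sup>2 * \<gamma>\<^sup>2 * real \<tau> * (real \<tau> + \<kappa>)) * S \<le> 1 / 4 * S"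
  proof (rule mult_right_mono[OF _ S])
    have "32 * L\<^sup>2 * \<gamma>\<^sup>2 * real \<tau> * (real \<tau> + \<kappa>) \<le> 32 * L\<^sup>2 * \<gamma>\<^sup>2 * real \<tau> * (real \<tau> + 2 * \<kappa>)"
      using kappa_pos by (intro mult_left_mono) auto
    then show "32 * L\<^sup>2 * \<gamma>\<^sup>2 * real \<tau> * (real \<tau> + \<kappa>) \<le> 1 / 4" using step_delay_sq by simp
  qed
  finally show ?thesis unfolding S_def d_def by simp
qed

abbreviation virtual where "virtual k \<omega> \<equiv> x k \<omega> - ebar k \<omega>"

lemma virtual_Suc: "virtual (Suc k) \<omega> = virtual k \<omega> - \<gamma> *\<^sub>R gbar k \<omega>"
proof -
  have "ebar (Suc k) \<omega> = ebar k \<omega> + \<gamma> *\<^sub>R gbar k \<omega> - average n (\<lambda>i. v i k \<omega>)"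
    by (simp add: average_def e_Suc sum.distrib sum_subtractf scaleR_add_right scaleR_diff_right
        scaleR_sum_right mult.commute)
  then show ?thesis by (simp add: x_Suc)
qed

lemma virtual_0: "virtual 0 \<omega> = x0"
  by (simp add: x_0 average_def e_0)

text \<open>With \<open>y\<close> the iterate and \<open>z\<close> the error, \<open>y - z\<close> is the virtual iterate. Young's inequality
  \<open>2\<langle>z, \<nabla>f(y)\<rangle> \<le> 2L\<parallel>z\<parallel>\<^sup>2 + \<parallel>\<nabla>f(y)\<parallel>\<^sup>2/(2L)\<close> uses up half of the gap, and moving the contraction from
  \<open>y\<close> to \<open>y - z\<close> costs another \<open>\<mu>\<parallel>z\<parallel>\<^sup>2 \<le> L\<parallel>z\<parallel>\<^sup>2\<close>.\<close>
lemma quasi_convex_descent: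
  fixes y z :: 'a
  shows "(norm (y - z - xs))\<^sup>2 - 2 * \<gamma> * ((y - z - xs) \<bullet> grad f y)
    \<le> (1 - \<gamma> * \<mu> / 2) * (norm (y - z - xs))\<^sup>2 - \<gamma> * (f y - f xs) + 3 * L * \<gamma> * (norm z)\<^sup>2"
proof -
  let ?g = "grad f y"
  have 1: "f y - f xs + \<mu> / 2 * (norm (y - xs))\<^sup>2 \<le> (y - xs) \<bullet> ?g"
  proof -
    have "f y + ?g \<bullet> (xs - y) + \<mu> / 2 * (norm (y - xs))\<^sup>2 \<le> f xs"
      using qsc by (simp add: quasi_strongly_convex_def)
    moreover have "?g \<bullet> (xs - y) = - ((y - xs) \<bullet> ?g)"
      by (simp add: inner_diff_left inner_diff_right inner_commute)
    ultimately show ?thesis by linarith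
  qed
  have 2: "2 * (z \<bullet> ?g) \<le> 2 * L * (norm z)\<^sup>2 + (f y - f xs)"
  proof -
    have "0 \<le> (norm ((2 * L) *\<^sub>R z - ?g))\<^sup>2" by simp
    also have "\<dots> = (2 * L)\<^sup>2 * (norm z)\<^sup>2 - 2 * (2 * L) * (z \<bullet> ?g) + (norm ?g)\<^sup>2"
      unfolding power2_norm_eq_inner by (simp add: inner_simps inner_commute power2_eq_square)
    also have "\<dots> \<le> (2 * L)\<^sup>2 * (norm z)\<^sup>2 - 2 * (2 * L) * (z \<bullet> ?g) + 2 * L * (f y - f xs)"
      using grad_norm_sq_le[of y] by simp
    finally have "0 \<le> (2 * L) * (2 * L * (norm z)\<^sup>2 - 2 * (z \<bullet> ?g) + (f y - f xs))"
      by (simp add: power2_eq_square algebra_simps)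
    then show ?thesis using L_pos by (simp add: zero_le_mult_iff)
  qed
  have 3: "(norm (y - z - xs))\<^sup>2 \<le> 2 * (norm (y - xs))\<^sup>2 + 2 * (norm z)\<^sup>2"
    using norm_add_sq_le[of "y - xs" "- z"] by (simp add: algebra_simps)
  have "\<mu> / 2 * (norm (y - z - xs))\<^sup>2 \<le> \<mu> / 2 * (2 * (norm (y - xs))\<^sup>2 + 2 * (norm z)\<^sup>2)"
    using 3 mu_nonneg by (intro mult_left_mono) auto
  moreover have "\<mu> * (norm z)\<^sup>2 \<le> L * (norm z)\<^sup>2" using mu_le_L by (intro mult_right_mono) auto
  moreover have "(y - z - xs) \<bullet> ?g = (y - xs) \<bullet> ?g - z \<bullet> ?g" by (simp add: inner_diff_left)
  ultimately have "- 2 * ((y - z - xs) \<bullet> ?g)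
      \<le> - (\<mu> / 2) * (norm (y - z - xs))\<^sup>2 - (f y - f xs) + 3 * L * (norm z)\<^sup>2"
    using 1 2 by (simp add: algebra_simps)
  from mult_left_mono[OF this, of \<gamma>] show ?thesis using step_pos by (simp add: algebra_simps)
qed

definition virtual_dist where "virtual_dist k = (\<integral>\<omega>. (norm (virtual k \<omega> - xs))\<^sup>2 \<partial>M)"

lemma virtual_sq: "sq_integrable M (\<lambda>\<omega>. virtual k \<omega> - xs)"
  by (intro sq_integrable_diff x_sq_integrable ebar_sq sq_integrable_const)

lemma virtual_dist_nonneg: "0 \<le> virtual_dist k" by (simp add: virtual_dist_def)

lemma virtual_dist_0: "virtual_dist 0 = (norm (x0 - xs))\<^sup>2"
  unfolding virtual_dist_def virtual_0 by (simp add: prob_space)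

text \<open>The virtual iterate belongs to the past, so in the mean \<open>g\<^sup>k\<close> may be replaced by \<open>\<nabla>f(x\<^sup>k)\<close> in
  the cross term. The gap part \<open>4\<kappa>L\<gamma>\<^sup>2\<close> of the second moment of \<open>g\<^sup>k\<close> is at most \<open>\<gamma>/2\<close>.\<close>
lemma virtual_recursion:
  "\<gamma> / 2 * (\<integral>\<omega>. gap k \<omega> \<partial>M) \<le> (1 - \<eta>) * virtual_dist k - virtual_dist (Suc k)
    + 3 * L * \<gamma> * (\<integral>\<omega>. (norm (ebar k \<omega>))\<^sup>2 \<partial>M) + \<gamma>\<^sup>2 * (2 / (real n)\<^sup>2 * V)"
proof -
  let ?u = "\<lambda>\<omega>. virtual k \<omega> - xs"
  have u_meas: "?u \<in> borel_measurable (samples (past k))"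
    using x_measurable[of k] ebar_measurable[of k] by measurable
  note i1 = sq_integrableD(2)[OF virtual_sq[of k]] and i2 = integrable_inner_sq[OF gbar_sq[of k] virtual_sq[of k]]
    and i3 = sq_integrableD(2)[OF gbar_sq[of k]] and i4 = integrable_inner_sq[OF grad_x_sq[of k] virtual_sq[of k]]
    and i5 = sq_integrableD(2)[OF ebar_sq[of k]]
  have "(norm (virtual (Suc k) \<omega> - xs))\<^sup>2
      = (norm (?u \<omega>))\<^sup>2 - 2 * \<gamma> * (gbar k \<omega> \<bullet> ?u \<omega>) + \<gamma>\<^sup>2 * (norm (gbar k \<omega>))\<^sup>2" for \<omega>
  proof -
    have "virtual (Suc k) \<omega> - xs = ?u \<omega> - \<gamma> *\<^sub>R gbar k \<omega>" by (simp add: virtual_Suc)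
    then show ?thesis by (simp only: norm_diff_sq inner_commute)
  qed
  then have "virtual_dist (Suc k) = (\<integral>\<omega>. (norm (?u \<omega>))\<^sup>2 - 2 * \<gamma> * (gbar k \<omega> \<bullet> ?u \<omega>) + \<gamma>\<^sup>2 * (norm (gbar k \<omega>))\<^sup>2 \<partial>M)"
    by (simp only: virtual_dist_def)
  also have "\<dots> = (\<integral>\<omega>. (norm (?u \<omega>))\<^sup>2 \<partial>M) - 2 * \<gamma> * (\<integral>\<omega>. gbar k \<omega> \<bullet> ?u \<omega> \<partial>M)
      + \<gamma>\<^sup>2 * (\<integral>\<omega>. (norm (gbar k \<omega>))\<^sup>2 \<partial>M)"
    using i1 i2 i3 by simp
  finally have expand: "virtual_dist (Suc k) = (\<integral>\<omega>. (norm (?u \<omega>))\<^sup>2 \<partial>M)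
      - 2 * \<gamma> * (\<integral>\<omega>. grad f (x k \<omega>) \<bullet> ?u \<omega> \<partial>M) + \<gamma>\<^sup>2 * (\<integral>\<omega>. (norm (gbar k \<omega>))\<^sup>2 \<partial>M)"
    unfolding gbar_inner_integral[OF u_meas virtual_sq] .
  have "(\<integral>\<omega>. (norm (?u \<omega>))\<^sup>2 \<partial>M) - 2 * \<gamma> * (\<integral>\<omega>. grad f (x k \<omega>) \<bullet> ?u \<omega> \<partial>M)
      = (\<integral>\<omega>. (norm (?u \<omega>))\<^sup>2 - 2 * \<gamma> * (?u \<omega> \<bullet> grad f (x k \<omega>)) \<partial>M)"
    using i1 i4 by (simp add: inner_commute[of "_ - xs"])
  also have "\<dots> \<le> (\<integral>\<omega>. (1 - \<eta>) * (norm (?u \<omega>))\<^sup>2 - \<gamma> * gap k \<omega> + 3 * L * \<gamma> * (norm (ebar k \<omega>))\<^sup>2 \<partial>M)"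
  proof (rule integral_mono)
    show "integrable M (\<lambda>\<omega>. (norm (?u \<omega>))\<^sup>2 - 2 * \<gamma> * (?u \<omega> \<bullet> grad f (x k \<omega>)))"
      using i1 i4 by (simp add: inner_commute[of "_ - xs"])
    show "integrable M (\<lambda>\<omega>. (1 - \<eta>) * (norm (?u \<omega>))\<^sup>2 - \<gamma> * gap k \<omega> + 3 * L * \<gamma> * (norm (ebar k \<omega>))\<^sup>2)"
      by (intro Bochner_Integration.integrable_add Bochner_Integration.integrable_diff integrable_mult_right
          i1 i5 gap_integrable)
  qed (unfold rate_eq, rule quasi_convex_descent)
  also have "\<dots> = (1 - \<eta>) * virtual_dist k - \<gamma> * (\<integral>\<omega>. gap k \<omega> \<partial>M) + 3 * L * \<gamma> * (\<integral>\<omega>. (norm (ebar k \<omega>))\<^sup>2 \<partial>M)"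
    unfolding virtual_dist_def
    by (simp only: Bochner_Integration.integral_add Bochner_Integration.integral_diff
        Bochner_Integration.integrable_diff integrable_mult_right i1 i5 gap_integrable integral_mult_right_zero)
  finally have descent: "(\<integral>\<omega>. (norm (?u \<omega>))\<^sup>2 \<partial>M) - 2 * \<gamma> * (\<integral>\<omega>. grad f (x k \<omega>) \<bullet> ?u \<omega> \<partial>M)
      \<le> (1 - \<eta>) * virtual_dist k - \<gamma> * (\<integral>\<omega>. gap k \<omega> \<partial>M) + 3 * L * \<gamma> * (\<integral>\<omega>. (norm (ebar k \<omega>))\<^sup>2 \<partial>M)" .
  have "\<gamma>\<^sup>2 * (\<integral>\<omega>. (norm (gbar k \<omega>))\<^sup>2 \<partial>M) \<le> \<gamma> / 2 * (\<integral>\<omega>. gap k \<omega> \<partial>M) + \<gamma>\<^sup>2 * (2 / (real n)\<^sup>2 * V)"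
  proof -
    have "0 \<le> (\<integral>\<omega>. gap k \<omega> \<partial>M)" by (intro Bochner_Integration.integral_nonneg gap_nonneg)
    then have "\<gamma> / 2 * ((8 * \<kappa> * L * \<gamma>) * (\<integral>\<omega>. gap k \<omega> \<partial>M)) \<le> \<gamma> / 2 * (1 * (\<integral>\<omega>. gap k \<omega> \<partial>M))"
      using step_le step_pos by (intro mult_left_mono mult_right_mono) auto
    moreover have "\<gamma>\<^sup>2 * (\<integral>\<omega>. (norm (gbar k \<omega>))\<^sup>2 \<partial>M)
        \<le> \<gamma>\<^sup>2 * (4 * \<kappa> * L * (\<integral>\<omega>. gap k \<omega> \<partial>M) + 2 / (real n)\<^sup>2 * V)"
      by (intro mult_left_mono gbar_second_moment) simp
    ultimately show ?thesis by (simp only: power2_eq_square distrib_left) (simp add: mult_ac)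
  qed
  with expand descent show ?thesis by linarith
qed

end

section \<open>Convergence rates\<close>

context delayed_sgd_rate
begin

lemma rate_parametric_assumption:
  assumes A: "A = 2 * \<kappa> * L"
  shows "parametric_assumption M (history M n D \<xi>) f L \<mu> \<gamma> n x g e (\<lambda>k \<omega>. 0) (\<lambda>k \<omega>. 0)
    \<lparr> par_A = A, par_B1 = 0, par_B2 = 0, par_C1 = 0, par_C2 = 0,
      par_D1 = 2 / (real n)\<^sup>2 * V, par_D2 = 0,
      par_D3 = 6 * \<gamma> * real \<tau> * L / (real n)\<^sup>2 * V,
      par_F1 = 0, par_F2 = 0, par_G = 0, par_rho1 = 1, par_rho2 = 1 \<rparr>"
proof -
  have zero: "AE \<omega> in M. real_cond_exp M (samples (past k)) (\<lambda>\<omega>. 0) \<omega> \<le> 0" for k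
  proof -
    interpret S: sigma_finite_subalgebra M "samples (past k)"
      by (rule sigma_finite_subalgebra_samples[OF past_subset])
    show ?thesis by (rule S.real_cond_exp_le_c) auto
  qed
  have mom: "AE \<omega> in M. real_cond_exp M (samples (past k)) (\<lambda>\<omega>. (norm (gbar k \<omega>))\<^sup>2) \<omega>
      \<le> 2 * A * gap k \<omega> + 2 / (real n)\<^sup>2 * V" for k
    using gbar_second_moment_cond[of k] unfolding A by (simp add: mult_ac)
  show ?thesis
    unfolding parametric_assumption_def Let_def history_eq_samples sgd_params.simps
  proof (intro conjI allI)
    fix k show "integrable M (gbar k)" by (rule sq_integrable_imp_integrable[OF gbar_sq])
    show "integrable M (\<lambda>\<omega>. (norm (gbar k \<omega>))\<^sup>2)" by (rule sq_integrableD(2)[OF gbar_sq])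
    show "integrable M (\<lambda>\<omega>. (norm (ebar k \<omega>))\<^sup>2)" by (rule sq_integrableD(2)[OF ebar_sq])
    show "integrable M (gap k)" by (rule gap_integrable)
    show "AE \<omega> in M. vec_cond_exp M (samples (past k)) (gbar k) \<omega> = grad f (x k \<omega>)"
      by (rule gbar_cond_exp)
  qed (use zero mom weighted_error_bound in auto)
qed

lemma weighted_average_bound:
  assumes cvx: "convex_on UNIV f"
  shows "integrable M (\<lambda>\<omega>. f (weighted_average \<eta> x K \<omega>) - f xs)"
    and "(\<integral>\<omega>. f (weighted_average \<eta> x K \<omega>) - f xs \<partial>M)
      \<le> 4 * (norm (x0 - xs))\<^sup>2 / \<gamma> / total_weight \<eta> K
        + 8 * \<gamma> / (real n)\<^sup>2 * (1 + 3 * L * \<gamma> * real \<tau>) * V"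
proof -
  let ?W = "total_weight \<eta> K"
  define a where "a k = weight \<eta> k / ?W" for k
  have W: "0 < ?W" by (rule total_weight_pos[OF rate_lt_1])
  have a_nonneg: "0 \<le> a k" for k
    using weight_pos[OF rate_lt_1, of k] W by (simp add: a_def)
  have a_sum: "(\<Sum>k\<le>K. a k) = 1"
    using W by (simp add: a_def total_weight_def flip: sum_divide_distrib)
  have xbar: "weighted_average \<eta> x K \<omega> = (\<Sum>k\<le>K. a k *\<^sub>R x k \<omega>)" for \<omega>
    by (simp add: weighted_average_def a_def scaleR_sum_right)
  have "sq_integrable M (weighted_average \<eta> x K)"
    unfolding xbar by (intro sq_integrable_sum sq_integrable_scaleR x_sq_integrable)
  then show int: "integrable M (\<lambda>\<omega>. f (weighted_average \<eta> x K \<omega>) - f xs)"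
    by (rule gap_integrable_of_sq)
  have jensen: "f (weighted_average \<eta> x K \<omega>) - f xs \<le> (\<Sum>k\<le>K. a k * gap k \<omega>)" for \<omega>
  proof -
    have "f (\<Sum>k\<le>K. a k *\<^sub>R x k \<omega>) \<le> (\<Sum>k\<le>K. a k * f (x k \<omega>))"
      by (rule convex_on_sum[OF _ _ cvx a_sum]) (use a_nonneg in auto)
    moreover have "(\<Sum>k\<le>K. a k * gap k \<omega>) = (\<Sum>k\<le>K. a k * f (x k \<omega>)) - f xs"
      using a_sum by (simp add: right_diff_distrib sum_subtractf flip: sum_distrib_right)
    ultimately show ?thesis by (simp add: xbar)
  qed
  have "(\<integral>\<omega>. f (weighted_average \<eta> x K \<omega>) - f xs \<partial>M) \<le> (\<integral>\<omega>. (\<Sum>k\<le>K. a k * gap k \<omega>) \<partial>M)"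
    by (intro integral_mono int jensen Bochner_Integration.integrable_sum integrable_mult_right gap_integrable)
  also have "\<dots> = (\<Sum>k\<le>K. a k * (\<integral>\<omega>. gap k \<omega> \<partial>M))"
    by (subst Bochner_Integration.integral_sum) (use gap_integrable in auto)
  also have "\<dots> = (\<Sum>k\<le>K. weight \<eta> k * (\<integral>\<omega>. gap k \<omega> \<partial>M)) / ?W"
    by (simp add: a_def sum_divide_distrib)
  also have "\<dots> \<le> (4 * virtual_dist 0 / \<gamma> + 4 * \<gamma> * (2 / (real n)\<^sup>2 * V + 6 * \<gamma> * real \<tau> * L / (real n)\<^sup>2 * V) * ?W) / ?W"
    using W by (intro divide_right_mono weighted_recursion_bound[OF rate_lt_1 step_pos virtual_dist_nonneg
        virtual_recursion weighted_error_bound]) auto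
  also have "\<dots> = 4 * virtual_dist 0 / \<gamma> / ?W + 4 * \<gamma> * (2 / (real n)\<^sup>2 * V + 6 * \<gamma> * real \<tau> * L / (real n)\<^sup>2 * V)"
    using W by (simp add: add_divide_distrib)
  also have "4 * \<gamma> * (2 / (real n)\<^sup>2 * V + 6 * \<gamma> * real \<tau> * L / (real n)\<^sup>2 * V)
      = 8 * \<gamma> / (real n)\<^sup>2 * (1 + 3 * L * \<gamma> * real \<tau>) * V"
    by (simp add: add_divide_distrib algebra_simps)
  finally show "(\<integral>\<omega>. f (weighted_average \<eta> x K \<omega>) - f xs \<partial>M)
      \<le> 4 * (norm (x0 - xs))\<^sup>2 / \<gamma> / ?W + 8 * \<gamma> / (real n)\<^sup>2 * (1 + 3 * L * \<gamma> * real \<tau>) * V"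
    by (simp add: virtual_dist_0)
qed

text \<open>The last weight alone gives \<open>W\<^sub>K \<ge> w\<^sub>K \<ge> (1 - \<eta>)\<^sup>-\<^sup>K\<close>.\<close>
lemma linear_rate:
  assumes "convex_on UNIV f"
  shows "(\<integral>\<omega>. f (weighted_average \<eta> x K \<omega>) - f xs \<partial>M)
    \<le> (1 - \<gamma> * \<mu> / 2) ^ K * (4 * (norm (x0 - xs))\<^sup>2 / \<gamma>)
      + 8 * \<gamma> / (real n)\<^sup>2 * (1 + 3 * L * \<gamma> * real \<tau>) * V"
proof -
  have eta: "0 < 1 - \<eta>" "1 - \<eta> \<le> 1" using rate_lt_1 rate_nonneg by auto
  have "inverse ((1 - \<eta>) ^ K) \<le> inverse ((1 - \<eta>) ^ (K + 1))"
    using eta by (intro le_imp_inverse_le) (auto intro: mult_left_le_one_le)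
  also have "\<dots> \<le> total_weight \<eta> K"
    unfolding total_weight_def weight_def[symmetric]
    using weight_pos[OF rate_lt_1] by (intro member_le_sum) (auto simp: less_imp_le)
  finally have "inverse (total_weight \<eta> K) \<le> inverse (inverse ((1 - \<eta>) ^ K))"
    using eta by (intro le_imp_inverse_le) auto
  then have "4 * (norm (x0 - xs))\<^sup>2 / \<gamma> * inverse (total_weight \<eta> K)
      \<le> 4 * (norm (x0 - xs))\<^sup>2 / \<gamma> * (1 - \<eta>) ^ K"
    using step_pos by (intro mult_left_mono) auto
  then have "4 * (norm (x0 - xs))\<^sup>2 / \<gamma> / total_weight \<eta> K
      \<le> (1 - \<eta>) ^ K * (4 * (norm (x0 - xs))\<^sup>2 / \<gamma>)"
    unfolding divide_inverse[of _ "total_weight \<eta> K"] by (simp only: mult.commute[of "(1 - \<eta>) ^ K"])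
  with weighted_average_bound(2)[OF assms, of K]
  have "(\<integral>\<omega>. f (weighted_average \<eta> x K \<omega>) - f xs \<partial>M)
      \<le> (1 - \<eta>) ^ K * (4 * (norm (x0 - xs))\<^sup>2 / \<gamma>)
        + 8 * \<gamma> / (real n)\<^sup>2 * (1 + 3 * L * \<gamma> * real \<tau>) * V"
    by linarith
  then show ?thesis by (simp only: rate_eq)
qed

text \<open>For \<open>\<mu> = 0\<close> all weights are 1.\<close>
lemma sublinear_rate:
  assumes "convex_on UNIV f" "\<mu> = 0" "0 < K"
  shows "(\<integral>\<omega>. f (weighted_average \<eta> x K \<omega>) - f xs \<partial>M)
    \<le> 4 * (norm (x0 - xs))\<^sup>2 / (\<gamma> * real K)
      + 8 * \<gamma> / (real n)\<^sup>2 * (1 + 3 * L * \<gamma> * real \<tau>) * V"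
proof -
  have "total_weight \<eta> K = real K + 1"
    unfolding rate_eq using assms(2) by (simp add: total_weight_def weight_def)
  then have "4 * (norm (x0 - xs))\<^sup>2 / \<gamma> / total_weight \<eta> K \<le> 4 * (norm (x0 - xs))\<^sup>2 / \<gamma> / real K"
    using assms(3) step_pos by (intro divide_left_mono) auto
  then have "4 * (norm (x0 - xs))\<^sup>2 / \<gamma> / total_weight \<eta> K \<le> 4 * (norm (x0 - xs))\<^sup>2 / (\<gamma> * real K)"
    by simp
  with weighted_average_bound(2)[OF assms(1), of K] show ?thesis by linarith
qed

end

theorem theoremK1:
  fixes M :: "'o measure"
    and D :: "nat \<Rightarrow> 's measure"
    and F :: "nat \<Rightarrow> 's \<Rightarrow> 'a::euclidean_space \<Rightarrow> real"
    and \<xi> :: "nat \<Rightarrow> nat \<Rightarrow> 'o \<Rightarrow> 's"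
    and n \<tau> :: nat
    and L \<mu> \<gamma> :: real
    and x0 :: 'a
    and x :: "nat \<Rightarrow> 'o \<Rightarrow> 'a"
    and g v e :: "nat \<Rightarrow> nat \<Rightarrow> 'o \<Rightarrow> 'a"
  assumes "delayed_sgd M n D F L \<xi> \<tau> \<gamma> x0 x g v e"
  shows
    "let f = objective n D F;
         xs = minimizer f;
         V = (\<Sum>i<n. grad_var D F i xs);
         xbar = weighted_average (rate \<gamma> \<mu> 1 1) x;
         \<kappa> = L / \<mu>
     in
      ((\<forall>i<n. \<forall>s\<in>space (D i). convex_on UNIV (F i s))
        \<and> 0 \<le> \<mu> \<and> quasi_strongly_convex \<mu> f
        \<and> 0 < \<gamma> \<and> \<gamma> \<le> 1 / (8 * L * sqrt (2 * real \<tau> * (real \<tau> + 2)))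
       \<longrightarrow>
        parametric_assumption M (history M n D \<xi>) f L \<mu> \<gamma> n x g e (\<lambda>k \<omega>. 0) (\<lambda>k \<omega>. 0)
          \<lparr> par_A = 2 * L, par_B1 = 0, par_B2 = 0, par_C1 = 0, par_C2 = 0,
            par_D1 = 2 / (real n)\<^sup>2 * V, par_D2 = 0,
            par_D3 = 6 * \<gamma> * real \<tau> * L / (real n)\<^sup>2 * V,
            par_F1 = 0, par_F2 = 0, par_G = 0, par_rho1 = 1, par_rho2 = 1 \<rparr>
        \<and> (\<forall>K. integrable M (\<lambda>\<omega>. f (xbar K \<omega>) - f xs))
        \<and> (\<mu> > 0 \<longrightarrow> (\<forall>K. (\<integral>\<omega>. f (xbar K \<omega>) - f xs \<partial>M)
              \<le> (1 - \<gamma> * \<mu> / 2) ^ K * (4 * (norm (x0 - xs))\<^sup>2 / \<gamma>)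
                 + 8 * \<gamma> / (real n)\<^sup>2 * (1 + 3 * L * \<gamma> * real \<tau>) * V))
        \<and> (\<mu> = 0 \<longrightarrow> (\<forall>K>0. (\<integral>\<omega>. f (xbar K \<omega>) - f xs \<partial>M)
              \<le> 4 * (norm (x0 - xs))\<^sup>2 / (\<gamma> * real K)
                 + 8 * \<gamma> / (real n)\<^sup>2 * (1 + 3 * L * \<gamma> * real \<tau>) * V)))
     \<and>
      (0 < \<mu> \<and> (\<forall>i<n. strongly_convex \<mu> (local_loss D F i))
        \<and> 0 < \<gamma>
        \<and> \<gamma> \<le> min (1 / (8 * \<kappa> * L)) (1 / (8 * L * sqrt (2 * real \<tau> * (real \<tau> + 2 * \<kappa>))))
       \<longrightarrow>
        parametric_assumption M (history M n D \<xi>) f L \<mu> \<gamma> n x g e (\<lambda>k \<omega>. 0) (\<lambda>k \<omega>. 0)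
          \<lparr> par_A = 2 * \<kappa> * L, par_B1 = 0, par_B2 = 0, par_C1 = 0, par_C2 = 0,
            par_D1 = 2 / (real n)\<^sup>2 * V, par_D2 = 0,
            par_D3 = 6 * \<gamma> * real \<tau> * L / (real n)\<^sup>2 * V,
            par_F1 = 0, par_F2 = 0, par_G = 0, par_rho1 = 1, par_rho2 = 1 \<rparr>
        \<and> (\<forall>K. integrable M (\<lambda>\<omega>. f (xbar K \<omega>) - f xs))
        \<and> (\<forall>K. (\<integral>\<omega>. f (xbar K \<omega>) - f xs \<partial>M)
              \<le> (1 - \<gamma> * \<mu> / 2) ^ K * (4 * (norm (x0 - xs))\<^sup>2 / \<gamma>)
                 + 8 * \<gamma> / (real n)\<^sup>2 * (1 + 3 * L * \<gamma> * real \<tau>) * V))"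
proof -
  interpret delayed_sgd M n D F L \<xi> \<tau> \<gamma> x0 x g v e by (rule assms)
  have part1: "parametric_assumption M (history M n D \<xi>) f L \<mu> \<gamma> n x g e (\<lambda>k \<omega>. 0) (\<lambda>k \<omega>. 0)
          \<lparr> par_A = 2 * L, par_B1 = 0, par_B2 = 0, par_C1 = 0, par_C2 = 0,
            par_D1 = 2 / (real n)\<^sup>2 * variance_at_min, par_D2 = 0,
            par_D3 = 6 * \<gamma> * real \<tau> * L / (real n)\<^sup>2 * variance_at_min,
            par_F1 = 0, par_F2 = 0, par_G = 0, par_rho1 = 1, par_rho2 = 1 \<rparr>
        \<and> (\<forall>K. integrable M (\<lambda>\<omega>. f (weighted_average (rate \<gamma> \<mu> 1 1) x K \<omega>) - f xs))
        \<and> (\<mu> > 0 \<longrightarrow> (\<forall>K. (\<integral>\<omega>. f (weighted_average (rate \<gamma> \<mu> 1 1) x K \<omega>) - f xs \<partial>M)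
              \<le> (1 - \<gamma> * \<mu> / 2) ^ K * (4 * (norm (x0 - xs))\<^sup>2 / \<gamma>)
                 + 8 * \<gamma> / (real n)\<^sup>2 * (1 + 3 * L * \<gamma> * real \<tau>) * variance_at_min))
        \<and> (\<mu> = 0 \<longrightarrow> (\<forall>K>0. (\<integral>\<omega>. f (weighted_average (rate \<gamma> \<mu> 1 1) x K \<omega>) - f xs \<partial>M)
              \<le> 4 * (norm (x0 - xs))\<^sup>2 / (\<gamma> * real K)
                 + 8 * \<gamma> / (real n)\<^sup>2 * (1 + 3 * L * \<gamma> * real \<tau>) * variance_at_min))"
    if cvx: "\<forall>i<n. \<forall>s\<in>space (D i). convex_on UNIV (F i s)" and mu: "0 \<le> \<mu>"
      and qsc: "quasi_strongly_convex \<mu> f"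
      and step: "0 < \<gamma>" "\<gamma> \<le> 1 / (8 * L * sqrt (2 * real \<tau> * (real \<tau> + 2)))"
  proof -
    have "grad f xs = 0"
      by (rule grad_minimum_eq_0[OF objective_differentiable quasi_strongly_convex_minimum[OF qsc]])
    then have growth: "sample_grad_growth 1" using cvx by (intro sample_grad_growth_convex) auto
    have "1 * 1 \<le> (2 * real \<tau>) * (real \<tau> + 2)" using delay_pos by (intro mult_mono) auto
    then have "1 \<le> sqrt (2 * real \<tau> * (real \<tau> + 2))" by simp
    then have "1 / (8 * L * sqrt (2 * real \<tau> * (real \<tau> + 2))) \<le> 1 / (8 * L * 1)"
      using L_pos by (intro divide_left_mono mult_left_mono mult_pos_pos) auto
    with step(2) have "\<gamma> \<le> 1 / (8 * L)" by simp
    then have "8 * 1 * L * \<gamma> \<le> 1" using L_pos by (simp add: field_simps)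
    then interpret delayed_sgd_rate M n D F L \<xi> \<tau> \<gamma> x0 x g v e \<mu> 1
      using qsc mu step growth by unfold_locales auto
    have "convex_on UNIV f" using cvx by (intro objective_convex) auto
    then show ?thesis
      using rate_parametric_assumption[of "2 * L"] weighted_average_bound(1) linear_rate sublinear_rate by simp
  qed
  have part2: "parametric_assumption M (history M n D \<xi>) f L \<mu> \<gamma> n x g e (\<lambda>k \<omega>. 0) (\<lambda>k \<omega>. 0)
          \<lparr> par_A = 2 * (L / \<mu>) * L, par_B1 = 0, par_B2 = 0, par_C1 = 0, par_C2 = 0,
            par_D1 = 2 / (real n)\<^sup>2 * variance_at_min, par_D2 = 0,
            par_D3 = 6 * \<gamma> * real \<tau> * L / (real n)\<^sup>2 * variance_at_min,
            par_F1 = 0, par_F2 = 0, par_G = 0, par_rho1 = 1, par_rho2 = 1 \<rparr>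
        \<and> (\<forall>K. integrable M (\<lambda>\<omega>. f (weighted_average (rate \<gamma> \<mu> 1 1) x K \<omega>) - f xs))
        \<and> (\<forall>K. (\<integral>\<omega>. f (weighted_average (rate \<gamma> \<mu> 1 1) x K \<omega>) - f xs \<partial>M)
              \<le> (1 - \<gamma> * \<mu> / 2) ^ K * (4 * (norm (x0 - xs))\<^sup>2 / \<gamma>)
                 + 8 * \<gamma> / (real n)\<^sup>2 * (1 + 3 * L * \<gamma> * real \<tau>) * variance_at_min)"
    if mu: "0 < \<mu>" and sc: "\<forall>i<n. strongly_convex \<mu> (local_loss D F i)"
      and step: "0 < \<gamma>" "\<gamma> \<le> min (1 / (8 * (L / \<mu>) * L)) (1 / (8 * L * sqrt (2 * real \<tau> * (real \<tau> + 2 * (L / \<mu>)))))"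
  proof -
    have scf: "strongly_convex \<mu> f" using sc by (intro objective_strongly_convex) auto
    have qsc: "quasi_strongly_convex \<mu> f" by (rule strongly_convex_imp_quasi[OF scf mu])
    have "grad f xs = 0"
      by (rule grad_minimum_eq_0[OF objective_differentiable quasi_strongly_convex_minimum[OF qsc]])
    then have growth: "sample_grad_growth (L / \<mu>)"
      by (rule sample_grad_growth_strongly_convex[OF scf mu])
    have "0 < 8 * (L / \<mu>) * L" using L_pos mu by simp
    then have "8 * (L / \<mu>) * L * \<gamma> \<le> 1"
      using step(2) pos_le_divide_eq[of "8 * (L / \<mu>) * L" \<gamma> 1] by (simp add: mult.commute)
    then interpret delayed_sgd_rate M n D F L \<xi> \<tau> \<gamma> x0 x g v e \<mu> "L / \<mu>"
      using qsc mu L_pos step growth by unfold_locales auto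
    have "convex_on UNIV f" using scf mu by (intro strongly_convex_imp_convex) auto
    then show ?thesis
      using rate_parametric_assumption[OF refl] weighted_average_bound(1) linear_rate by blast
  qed
  show ?thesis
    unfolding Let_def variance_at_min_def[symmetric] using part1 part2 by blast
qed

end
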